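(* Let $F$ denote the set of polynomials of the form $t^3-t^2+at+b\in\mathbb{Z}[t]$ which have Galois group $C_3$ (cyclic of order three) over $\mathbb{Q}$. For any real $H\ge 1$ let $E_H\subset\mathbb{R}^2$ be the ellipse defined by $$E_H:\quad x^2+y^2+xy-x-y=\tfrac13(H^2-1).$$ If $t^3-t^2+at+b\in F$ then $a\le 0$. Fix $a\in\mathbb{Z}_{\le 0}$. The number of polynomials of the form $t^3-t^2+at+b\in F$ (for any $b\in\mathbb{Z}$) is equal to $$\frac12\sum_{d\mid(1-3a)}3^{\omega(P_1(d))}(-1)^{\Omega(P_2(d))}-\frac16\,\#E_{\sqrt{1-3a}}(\mathbb{Z}).$$
   Context: The sum runs over positive divisors $d$ of $1-3a$. $P_j(d)$ denotes the largest divisor of $d$ only divisible by primes $\equiv j\pmod 3$. $\omega(n)$ (resp. $\Omega(n)$) denotes the number of prime factors of a positive integer $n$ counted without (resp. with) multiplicity. $E_H(\mathbb{Z})=E_H\cap\mathbb{Z}^2$ is the set of integer points on the ellipse. *)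

theory Defs
  imports
    Complex_Main
    "HOL-Computational_Algebra.Computational_Algebra"
    "HOL-Algebra.Generated_Fields"
    "HOL-Algebra.Algebraic_Closure_Type"
    "HOL-Algebra.Elementary_Groups"
    "HOL-Algebra.Bij"
begin

abbreviation complex_field :: "complex ring" where
  "complex_field \<equiv> ring_of_type_algebra"

definition splitting_field :: "rat poly \<Rightarrow> complex set" where
  "splitting_field f =
     generate_field complex_field (\<rat> \<union> {z. poly (map_poly of_rat f) z = 0})"

(* The automorphisms are taken extensional (undefined outside the splitting field), so that
   each automorphism is represented by exactly one HOL function; the group operation,
   inherited from BijGroup, is composition. *)
definition galois_group :: "rat poly \<Rightarrow> (complex \<Rightarrow> complex) monoid" where
  "galois_group f =
     (let L = splitting_field f; R = complex_field\<lparr>carrier := L\<rparr>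
      in BijGroup L\<lparr>carrier := {\<sigma> \<in> ring_iso R R \<inter> extensional L. \<forall>q\<in>\<rat>. \<sigma> q = q}\<rparr>)"

definition F :: "int poly set" where
  "F = {f. (\<exists>a b. f = [:b, a, -1, 1:]) \<and>
           galois_group (map_poly of_int f) \<cong> integer_mod_group 3}"

definition E :: "real \<Rightarrow> (real \<times> real) set" where
  "E H = {(x, y). x\<^sup>2 + y\<^sup>2 + x * y - x - y = 1/3 * (H\<^sup>2 - 1)}"

(* The name is qualified because HOL-Algebra has its own constant "prime". *)
definition P :: "nat \<Rightarrow> nat \<Rightarrow> nat" where
  "P j d = Max {e. e dvd d \<and> (\<forall>p. Factorial_Ring.prime p \<and> p dvd e \<longrightarrow> p mod 3 = j mod 3)}"

definition \<omega> :: "nat \<Rightarrow> nat" where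
  "\<omega> n = card (prime_factors n)"

definition \<Omega> :: "nat \<Rightarrow> nat" where
  "\<Omega> n = size (prime_factorization n)"

end

theory Submission
  imports Defs "HOL-Number_Theory.Number_Theory" "HOL-Library.Discrete_Functions"
begin

text \<open>
  Put \<open>n = 1 - 3 a\<close> and let \<open>x, y, z\<close> be the complex roots of \<open>f = t\<^sup>3 - t\<^sup>2 + a t + b\<close>.
  The Galois group of \<open>f\<close> over the rationals is cyclic of order three exactly if \<open>f\<close> has no
  rational root and \<open>\<delta> = (x - y) (y - z) (z - x)\<close> is rational (\<open>galois_group_cyclic_iff\<close>).
  If \<open>\<delta>\<close> is rational, then \<open>y\<close> and \<open>z\<close> are rational polynomials in \<open>x\<close>, and the automorphisms are
  given by \<open>x \<mapsto> x\<close>, \<open>x \<mapsto> y\<close>, \<open>x \<mapsto> z\<close>. Conversely an automorphism of order three permutes the roots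
  cyclically, so that no root is rational and \<open>\<delta>\<close> is fixed; if \<open>\<delta>\<close> were irrational, then
  \<open>\<delta> \<mapsto> - \<delta>\<close> would define an automorphism over \<open>\<rat>(x)\<close>, an involution that a group of order
  three does not have.

  The substitution \<open>t = (s + 1) / 3\<close> turns \<open>27 f\<close> into \<open>s\<^sup>3 - 3 n s + m\<close> with \<open>m = 27 b + 9 a - 2\<close>,
  hence \<open>27 \<delta>\<^sup>2 = 4 n\<^sup>3 - m\<^sup>2\<close>. As rational algebraic integers are integers, membership of \<open>f\<close> in \<open>F\<close> means
  that \<open>f\<close> has no integer root and that \<open>m\<^sup>2 + 27 k\<^sup>2 = 4 n\<^sup>3\<close> for an integer \<open>k\<close> (\<open>mem_F_iff\<close>). In particular
  \<open>n \<ge> 0\<close>, that is \<open>a \<le> 0\<close>. The pairs \<open>(b, k)\<close> that solve this equation fall into two classes.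
  If \<open>f\<close> has no integer root, then \<open>k \<noteq> 0\<close>, and every polynomial in \<open>F\<close> belongs to exactly two pairs.
  If \<open>f\<close> has an integer root, then all roots are integers; the integer points \<open>(x, y)\<close> of the ellipse are the
  first two entries of the orderings of such root triples, and each pair \<open>(b, k)\<close> comes from exactly
  three of them, namely from a cyclic class of orderings. If \<open>N\<close> is the number of all pairs, the number of
  polynomials in \<open>F\<close> is therefore \<open>N / 2\<close> minus one sixth of the number of points of the ellipse.

  It remains to evaluate \<open>N\<close>. Writing \<open>4 n\<^sup>3 = m\<^sup>2 + 27 k\<^sup>2\<close> as a norm identity, \<open>N\<close> is the number of Eisenstein
  integers of norm \<open>n\<^sup>3\<close> that are congruent to \<open>1\<close> modulo \<open>3\<close> (\<open>bij_square_disc\<close>). Denote by \<open>r(M)\<close> the number of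
  such elements of norm \<open>M\<close>. Inclusion-exclusion over the two prime elements above \<open>p\<close> gives
  \<open>r(p M) + r(M / p) = 2 r(M)\<close> for primes \<open>p \<equiv> 1\<close>, and \<open>r(p M) = r(M / p)\<close> holds for primes \<open>p \<equiv> 2\<close> modulo \<open>3\<close>, where
  \<open>r(M / p) = 0\<close> unless \<open>p\<close> divides \<open>M\<close>. For \<open>c\<close> prime to \<open>p\<close> it follows that \<open>r((p\<^sup>e c)\<^sup>3)\<close> is \<open>(3 e + 1) r(c\<^sup>3)\<close> for
  \<open>p \<equiv> 1\<close>, while for \<open>p \<equiv> 2\<close> it is \<open>r(c\<^sup>3)\<close> or \<open>0\<close> according to the parity of \<open>e\<close>. The divisor sum obeys the same rule,
  which proves \<open>N = r(n\<^sup>3)\<close> to be equal to it (\<open>card_primary_of_norm_cube\<close>).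
\<close>

section \<open>Primary Eisenstein integers of given norm\<close>

text \<open>The pair \<open>(x, y)\<close> stands for \<open>x + y \<zeta>\<close>, where \<open>\<zeta>\<^sup>2 + \<zeta> + 1 = 0\<close>.\<close>

definition eis_norm :: "int \<times> int \<Rightarrow> int" where
  "eis_norm = (\<lambda>(x, y). x * x - x * y + y * y)"

definition eis_mult :: "int \<times> int \<Rightarrow> int \<times> int \<Rightarrow> int \<times> int" where
  "eis_mult = (\<lambda>(x, y) (u, v). (x * u - y * v, x * v + y * u - y * v))"

definition eis_conj :: "int \<times> int \<Rightarrow> int \<times> int" where
  "eis_conj = (\<lambda>(x, y). (x - y, - y))"

definition eis_dvd :: "int \<Rightarrow> int \<times> int \<Rightarrow> bool" where
  "eis_dvd q = (\<lambda>(x, y). q dvd x \<and> q dvd y)"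

text \<open>Every class modulo \<open>3\<close> prime to \<open>3\<close> contains exactly one of the six units, so each element of norm
prime to \<open>3\<close> has exactly one primary associate: primary elements represent the ideals prime to \<open>3\<close>, and they are
closed under multiplication.\<close>

definition primary :: "int \<times> int \<Rightarrow> bool" where
  "primary = (\<lambda>(x, y). [x = 1] (mod 3) \<and> [y = 0] (mod 3))"

definition primary_of_norm :: "int \<Rightarrow> (int \<times> int) set" where
  "primary_of_norm M = {\<beta>. eis_norm \<beta> = M \<and> primary \<beta>}"

lemma eis_norm_mult: "eis_norm (eis_mult \<alpha> \<beta>) = eis_norm \<alpha> * eis_norm \<beta>"
  by (cases \<alpha>; cases \<beta>) (simp add: eis_norm_def eis_mult_def algebra_simps)

lemma eis_norm_conj: "eis_norm (eis_conj \<alpha>) = eis_norm \<alpha>"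
  by (cases \<alpha>) (simp add: eis_norm_def eis_conj_def algebra_simps)

lemma eis_conj_conj [simp]: "eis_conj (eis_conj \<alpha>) = \<alpha>"
  by (cases \<alpha>) (simp add: eis_conj_def)

text \<open>This identity makes quotients unnecessary: \<open>\<beta>\<close> is a multiple of an element \<open>\<pi>\<close> of norm \<open>p\<close>
if and only if \<open>p\<close> divides both coordinates of the product of \<open>\<beta>\<close> with the conjugate of \<open>\<pi>\<close>.\<close>

lemma eis_mult_conj_left:
  "eis_mult (eis_conj \<alpha>) (eis_mult \<alpha> \<beta>) = eis_mult (eis_norm \<alpha>, 0) \<beta>"
  by (cases \<alpha>; cases \<beta>) (simp add: eis_norm_def eis_mult_def eis_conj_def algebra_simps)

lemma eis_mult_scalar: "eis_mult (c, 0) (x, y) = (c * x, c * y)"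
  by (simp add: eis_mult_def)

lemma eis_mult_scalar_right: "eis_mult \<alpha> (eis_mult (c, 0) \<beta>) = eis_mult (c, 0) (eis_mult \<alpha> \<beta>)"
  by (cases \<alpha>; cases \<beta>) (simp add: eis_mult_def algebra_simps)

lemma inj_eis_mult_scalar: "c \<noteq> 0 \<Longrightarrow> inj (eis_mult (c, 0))"
  by (auto intro!: injI simp: eis_mult_scalar)

lemma inj_eis_mult:
  assumes "eis_norm \<alpha> \<noteq> 0"
  shows "inj (eis_mult \<alpha>)"
proof (rule injI)
  fix \<beta> \<gamma> assume "eis_mult \<alpha> \<beta> = eis_mult \<alpha> \<gamma>"
  then have "eis_mult (eis_norm \<alpha>, 0) \<beta> = eis_mult (eis_norm \<alpha>, 0) \<gamma>"
    by (metis eis_mult_conj_left)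
  then show "\<beta> = \<gamma>" using inj_eis_mult_scalar[OF assms] by (simp add: inj_eq)
qed

lemma primary_mult: 
  assumes "primary \<alpha>" "primary \<beta>" shows "primary (eis_mult \<alpha> \<beta>)"
proof -
  obtain x y u v where ab: "\<alpha> = (x, y)" "\<beta> = (u, v)" by (cases \<alpha>; cases \<beta>)
  have h: "[x = 1] (mod 3)" "[y = 0] (mod 3)" "[u = 1] (mod 3)" "[v = 0] (mod 3)"
    using assms by (simp_all add: ab primary_def)
  have "[x * u - y * v = 1 * 1 - 0 * 0] (mod 3)" "[x * v + y * u - y * v = 1 * 0 + 0 * 1 - 0 * 0] (mod 3)"
    by (intro cong_add cong_diff cong_mult h)+
  then show ?thesis unfolding ab primary_def eis_mult_def by simp
qed

lemma primary_conj: "primary \<alpha> \<Longrightarrow> primary (eis_conj \<alpha>)"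
  unfolding primary_def eis_conj_def using cong_diff[of _ 1 3 _ 0] by (auto simp: cong_minus_minus_iff cong_0_iff)

lemma primary_scalarD:
  assumes "[c = 1] (mod 3)" "primary (eis_mult (c, 0) \<beta>)"
  shows "primary \<beta>"
proof -
  obtain x y where b: "\<beta> = (x, y)" by (cases \<beta>)
  have "[c * x = 1 * x] (mod 3)" "[c * y = 1 * y] (mod 3)" by (intro cong_mult assms(1) cong_refl)+
  with assms(2) show ?thesis unfolding b primary_def eis_mult_scalar
    by (metis (no_types, lifting) case_prod_conv cong_sym cong_trans mult_1)
qed

lemma primary_scalar: "[c = 1] (mod 3) \<Longrightarrow> primary (c, 0)"
  by (simp add: primary_def)

lemma eis_dvdE:
  assumes "eis_dvd q \<beta>" obtains \<gamma> where "\<beta> = eis_mult (q, 0) \<gamma>"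
proof -
  obtain a b where "\<beta> = (q * a, q * b)"
    using assms unfolding eis_dvd_def by (cases \<beta>) (auto elim!: dvdE)
  then show ?thesis using that[of "(a, b)"] by (simp add: eis_mult_scalar)
qed

lemma eis_dvd_scalar [simp]: "eis_dvd q (eis_mult (q, 0) \<gamma>)"
  by (cases \<gamma>) (simp add: eis_dvd_def eis_mult_scalar)

lemma eis_norm_scalar: "eis_norm (c, 0) = c * c"
  by (simp add: eis_norm_def)

lemma finite_primary_of_norm: "finite (primary_of_norm M)"
proof (rule finite_subset)
  show "primary_of_norm M \<subseteq> {-4*\<bar>M\<bar>..4*\<bar>M\<bar>} \<times> {-4*\<bar>M\<bar>..4*\<bar>M\<bar>}"
  proof (clarify)
    fix x y assume "(x, y) \<in> primary_of_norm M"
    then have e: "x * x - x * y + y * y = M" by (simp add: primary_of_norm_def eis_norm_def)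
    have ab: "\<bar>z\<bar> \<le> z * z" for z :: int
      using mult_left_mono[of 1 "\<bar>z\<bar>" "\<bar>z\<bar>"] by (cases "z = 0") auto
    \<comment> \<open>completing the square in either variable bounds both coordinates\<close>
    have "4 * M = (2*x-y)*(2*x-y) + 3 * (y*y)" "4 * M = (2*y-x)*(2*y-x) + 3 * (x*x)"
      using e by (auto simp: algebra_simps)
    then have "3 * (y*y) \<le> 4 * M" "3 * (x*x) \<le> 4 * M" by (smt (verit) zero_le_square)+
    with ab[of x] ab[of y] show "x \<in> {-4*\<bar>M\<bar>..4*\<bar>M\<bar>} \<and> y \<in> {-4*\<bar>M\<bar>..4*\<bar>M\<bar>}" by auto
  qed
qed simp

text \<open>The congruence for \<open>q\<close> keeps the quotient primary. For a prime \<open>p \<equiv> 2\<close> modulo \<open>3\<close> the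
scalar to use is \<open>q = - p\<close>.\<close>

lemma primary_of_norm_scalar_multiples:
  assumes q: "[q = 1] (mod 3)" "q \<noteq> 0"
  shows "{\<beta> \<in> primary_of_norm (q * q * M). eis_dvd q \<beta>} = eis_mult (q, 0) ` primary_of_norm M"
proof (intro equalityI subsetI)
  fix \<beta> assume b: "\<beta> \<in> {\<beta> \<in> primary_of_norm (q * q * M). eis_dvd q \<beta>}"
  then obtain \<gamma> where g: "\<beta> = eis_mult (q, 0) \<gamma>" using eis_dvdE by blast
  have "\<gamma> \<in> primary_of_norm M" using b q primary_scalarD[OF q(1), of \<gamma>] unfolding g primary_of_norm_def
    by (simp add: eis_norm_mult eis_norm_scalar)
  then show "\<beta> \<in> eis_mult (q, 0) ` primary_of_norm M" using g by blast
qed (use q in \<open>auto simp: primary_of_norm_def eis_norm_mult eis_norm_scalar intro!: primary_mult primary_scalar\<close>)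

lemma card_primary_of_norm_scalar_multiples:
  assumes q: "[q = 1] (mod 3)" "q \<noteq> 0"
  shows "card {\<beta> \<in> primary_of_norm N. eis_dvd q \<beta>} = (if q * q dvd N then card (primary_of_norm (N div (q * q))) else 0)"
proof (cases "q * q dvd N")
  case True
  then obtain M where N: "N = q * q * M" by blast
  show ?thesis unfolding N primary_of_norm_scalar_multiples[OF q]
    using q inj_eis_mult_scalar[of q] by (simp add: card_image inj_on_subset)
next
  case False
  have "{\<beta> \<in> primary_of_norm N. eis_dvd q \<beta>} = {}"
    using False by (auto simp: primary_of_norm_def eis_norm_mult eis_norm_scalar elim!: eis_dvdE)
  then show ?thesis unfolding \<open>{\<beta> \<in> primary_of_norm N. eis_dvd q \<beta>} = {}\<close> using False by simp
qed

text \<open>A prime \<open>p\<close> that is the norm of \<open>\<pi>\<close> factors as \<open>\<pi>\<close> times its conjugate; if \<open>p\<close> divides the norm of \<open>\<beta>\<close>,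
one of the two factors divides \<open>\<beta>\<close>. Modulo \<open>p\<close> the two norm forms have the same two linear factors, which
is the polynomial identity that the proof starts from.\<close>

lemma norm_divisible_split:
  assumes p: "Factorial_Ring.prime (p::int)" and "p dvd eis_norm \<beta>" "eis_norm \<pi> = p"
  shows "eis_dvd p (eis_mult \<pi> \<beta>) \<or> eis_dvd p (eis_mult (eis_conj \<pi>) \<beta>)"
proof -
  obtain x y u v where ab: "\<beta> = (x, y)" "\<pi> = (u, v)" by (cases \<beta>; cases \<pi>)
  have N: "p dvd x*x-x*y+y*y" "u*u-u*v+v*v = p" using assms unfolding ab eis_norm_def by auto
  have "(v*x-u*y)*(v*x+u*y-v*y) = v*v*(x*x-x*y+y*y) - y*y*(u*u-u*v+v*v)" by (simp add: algebra_simps)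
  then have "p dvd (v*x-u*y)*(v*x+u*y-v*y)" using N by simp
  then consider "p dvd v*x-u*y" | "p dvd v*x+u*y-v*y" using p prime_dvd_mult_iff by blast
  \<comment> \<open>The two factors are the second coordinates of the two products; the norm then controls the first ones.\<close>
  moreover have "eis_dvd p (a, b)" if "p dvd b" "p dvd eis_norm (a, b)" for a b
  proof -
    have "a * a = eis_norm (a, b) + b * (a - b)" by (simp add: eis_norm_def algebra_simps)
    then have "p dvd a * a" using that by simp
    then show ?thesis using p that prime_dvd_mult_iff by (auto simp: eis_dvd_def)
  qed
  moreover have "p dvd eis_norm (eis_mult \<pi> \<beta>)" "p dvd eis_norm (eis_mult (eis_conj \<pi>) \<beta>)"
    using assms by (simp_all add: eis_norm_mult eis_norm_conj)
  moreover have "snd (eis_mult \<pi> \<beta>) = v*x+u*y-v*y" "snd (eis_mult (eis_conj \<pi>) \<beta>) = -(v*x-u*y)"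
    by (simp_all add: ab eis_mult_def eis_conj_def algebra_simps)
  ultimately show ?thesis
    by (metis dvd_minus_iff prod.collapse)
qed

text \<open>Membership on the right means divisibility by \<open>\<pi>\<close>: the cofactor is the product of \<open>\<beta>\<close> with the conjugate
of \<open>\<pi>\<close>, divided by \<open>p\<close>.\<close>

lemma primary_of_norm_multiples:
  assumes \<pi>: "\<pi> \<in> primary_of_norm p" and p: "p > 0" "[p = 1] (mod 3)"
  shows "eis_mult \<pi> ` primary_of_norm M = {\<beta> \<in> primary_of_norm (p * M). eis_dvd p (eis_mult (eis_conj \<pi>) \<beta>)}"
proof (intro equalityI subsetI)
  fix \<beta> assume b: "\<beta> \<in> {\<beta> \<in> primary_of_norm (p * M). eis_dvd p (eis_mult (eis_conj \<pi>) \<beta>)}"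
  then obtain \<gamma> where g: "eis_mult (eis_conj \<pi>) \<beta> = eis_mult (p, 0) \<gamma>" using eis_dvdE by blast
  have "eis_mult (p, 0) (eis_mult \<pi> \<gamma>) = eis_mult (eis_conj (eis_conj \<pi>)) (eis_mult (eis_conj \<pi>) \<beta>)"
    by (simp add: g eis_mult_scalar_right)
  also have "\<dots> = eis_mult (p, 0) \<beta>"
    using \<pi> unfolding eis_mult_conj_left by (simp add: eis_norm_conj primary_of_norm_def)
  finally have "eis_mult \<pi> \<gamma> = \<beta>" using inj_eis_mult_scalar[of p] p by (simp add: inj_eq)
  moreover have "primary \<gamma>"
    using primary_scalarD[OF p(2)] b g \<pi> by (metis (no_types, lifting) mem_Collect_eq primary_conj primary_mult primary_of_norm_def)
  moreover have "p * (p * M) = p * (p * eis_norm \<gamma>)"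
    using arg_cong[OF g, of eis_norm] b \<pi> by (simp add: eis_norm_mult eis_norm_conj eis_norm_scalar primary_of_norm_def)
  ultimately show "\<beta> \<in> eis_mult \<pi> ` primary_of_norm M" using p by (auto simp: primary_of_norm_def)
qed (use \<pi> in \<open>auto simp: primary_of_norm_def eis_norm_mult eis_mult_conj_left intro!: primary_mult\<close>)

text \<open>The elements of norm \<open>p M\<close> are the multiples of \<open>\<pi>\<close> together with those of its conjugate, and
each kind is counted by the elements of norm \<open>M\<close>. The elements counted twice are the multiples of \<open>p\<close>, because \<open>\<pi>\<close> and
its conjugate are coprime; they are counted by the elements of norm \<open>M / p\<close>.\<close>

lemma card_primary_of_norm_split_prime:
  assumes p: "Factorial_Ring.prime (p::int)" "[p = 1] (mod 3)" and \<pi>: "\<pi> \<in> primary_of_norm p"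
  shows "card (primary_of_norm (p * M)) + (if p dvd M then card (primary_of_norm (M div p)) else 0) = 2 * card (primary_of_norm M)"
proof -
  have p0: "p > 0" using p prime_gt_0_int by blast
  define A where "A = eis_mult \<pi> ` primary_of_norm M"
  define B where "B = eis_mult (eis_conj \<pi>) ` primary_of_norm M"
  have \<pi>c: "eis_conj \<pi> \<in> primary_of_norm p" using \<pi> by (simp add: primary_of_norm_def eis_norm_conj primary_conj)
  have N: "eis_norm \<pi> = p" using \<pi> by (simp add: primary_of_norm_def)
  have A: "A = {\<beta> \<in> primary_of_norm (p * M). eis_dvd p (eis_mult (eis_conj \<pi>) \<beta>)}"
    unfolding A_def using primary_of_norm_multiples[OF \<pi> p0 p(2)] .
  have B: "B = {\<beta> \<in> primary_of_norm (p * M). eis_dvd p (eis_mult \<pi> \<beta>)}"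
    unfolding B_def using primary_of_norm_multiples[OF \<pi>c p0 p(2)] by simp
  have fin: "finite A" "finite B" by (simp_all add: A_def B_def finite_primary_of_norm)
  have card: "card A = card (primary_of_norm M)" "card B = card (primary_of_norm M)"
    unfolding A_def B_def using N p0
    by (auto intro!: card_image inj_on_subset[OF inj_eis_mult] simp: eis_norm_conj)
  have un: "A \<union> B = primary_of_norm (p * M)"
  proof -
    have "eis_dvd p (eis_mult \<pi> \<beta>) \<or> eis_dvd p (eis_mult (eis_conj \<pi>) \<beta>)"
      if "\<beta> \<in> primary_of_norm (p * M)" for \<beta>
      using norm_divisible_split[OF p(1) _ N, of \<beta>] that by (simp add: primary_of_norm_def)
    then show ?thesis unfolding A B by blast
  qed
  have "A \<inter> B = {\<beta> \<in> primary_of_norm (p * M). eis_dvd p \<beta>}"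
  proof (intro equalityI subsetI)
    fix \<beta> assume b: "\<beta> \<in> A \<inter> B"
    obtain x y u v where ab: "\<beta> = (x, y)" "\<pi> = (u, v)" by (cases \<beta>; cases \<pi>)
    have Nuv: "u*u-u*v+v*v = p" using N unfolding ab eis_norm_def by simp
    \<comment> \<open>The trace of \<open>\<pi>\<close> is prime to \<open>p\<close>, which is what makes \<open>\<pi>\<close> and its conjugate coprime.\<close>
    have nd: "\<not> p dvd 2 * u - v"
    proof
      assume d: "p dvd 2 * u - v"
      have e: "4 * p = (2*u-v)*(2*u-v) + 3*(v*v)" using Nuv by (simp add: algebra_simps)
      have "p dvd 3 * (v*v)" using d e by (metis dvd_add_right_iff dvd_mult2 dvd_triv_right)
      moreover have "\<not> p dvd 3"
      proof
        assume "p dvd 3"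
        then have "p \<le> 3" by (simp add: zdvd_imp_le)
        then have "p = 2 \<or> p = 3" using prime_ge_2_int[OF p(1)] by auto
        then show False using p by (auto simp: cong_def)
      qed
      ultimately have pv: "p dvd v" using p prime_dvd_mult_iff by blast
      have "u * u = p - v * (v - u)" using Nuv by (simp add: algebra_simps)
      then have "p dvd u * u" using pv by simp
      then have pu: "p dvd u" using p prime_dvd_mult_iff by blast
      obtain a b where "u = p * a" "v = p * b" using pu pv by (auto elim!: dvdE)
      then have "p * 1 = p * (p * (a*a-a*b+b*b))" using Nuv by (simp add: algebra_simps)
      then have "p dvd 1" using p0 by (metis dvd_triv_left mult_left_cancel less_irrefl)
      then show False using p(1) not_prime_unit by blast
    qed
    have m: "p dvd fst (eis_mult \<pi> \<beta>)" "p dvd snd (eis_mult \<pi> \<beta>)" 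
      "p dvd fst (eis_mult (eis_conj \<pi>) \<beta>)" "p dvd snd (eis_mult (eis_conj \<pi>) \<beta>)"
      using b unfolding A B eis_dvd_def by (auto split: prod.splits)
    \<comment> \<open>adding both products multiplies \<open>\<beta>\<close> by the trace\<close>
    have "fst (eis_mult \<pi> \<beta>) + fst (eis_mult (eis_conj \<pi>) \<beta>) = (2*u-v)*x"
      "snd (eis_mult \<pi> \<beta>) + snd (eis_mult (eis_conj \<pi>) \<beta>) = (2*u-v)*y"
      by (simp_all add: ab eis_mult_def eis_conj_def algebra_simps)
    then have "p dvd (2*u-v)*x" "p dvd (2*u-v)*y" using m dvd_add by metis+
    then have "eis_dvd p \<beta>" using nd p prime_dvd_mult_iff by (auto simp: ab eis_dvd_def)
    then show "\<beta> \<in> {\<beta> \<in> primary_of_norm (p * M). eis_dvd p \<beta>}" using b A by blast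
  qed (auto simp: A B eis_mult_scalar_right elim!: eis_dvdE)
  then have "card (A \<inter> B) = (if p dvd M then card (primary_of_norm (M div p)) else 0)"
    using card_primary_of_norm_scalar_multiples[OF p(2), of "p * M"] p0 by simp
  then show ?thesis using card_Un_Int[OF fin] card un by simp
qed

text \<open>If \<open>p\<close> divides the norm \<open>x\<^sup>2 - x y + y\<^sup>2\<close>, it divides \<open>x\<^sup>3 + y\<^sup>3\<close>. As \<open>p - 1 = 3 k + 1\<close>, Fermat's little
theorem allows extracting cube roots modulo \<open>p\<close> up to sign, so \<open>x \<equiv> y\<close> or \<open>x \<equiv> - y\<close>; then \<open>p\<close> divides \<open>x\<^sup>2\<close> or \<open>3 x\<^sup>2\<close>.\<close>

lemma inert_prime_dvd:
  assumes p: "Factorial_Ring.prime (p::nat)" "p mod 3 = 2" and d: "int p dvd eis_norm \<beta>"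
  shows "eis_dvd (int p) \<beta>"
proof -
  obtain x y where ab: "\<beta> = (x, y)" by (cases \<beta>)
  have N: "int p dvd x*x-x*y+y*y" using d unfolding ab eis_norm_def by simp
  have pp: "Factorial_Ring.prime (int p)" using p by simp
  have p3: "\<not> int p dvd 3"
  proof
    assume "int p dvd 3" 
    then have "int p \<le> 3" by (intro zdvd_imp_le) auto
    then have "p = 2 \<or> p = 3" using prime_ge_2_nat[OF p(1)] by auto
    then have "p = 2" using p by auto
    with \<open>int p dvd 3\<close> have False by simp
    then show False using p by simp
  qed
  have yx: "int p dvd x" if "int p dvd y"
  proof -
    have "x * x = (x*x-x*y+y*y) + y * (x - y)" by (simp add: algebra_simps)
    then have "int p dvd x * x" using that N by (metis dvd_add dvd_mult2)
    then show ?thesis using pp prime_dvd_mult_iff by blast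
  qed
  have xy: "int p dvd y" if "int p dvd x"
  proof -
    have "y * y = (x*x-x*y+y*y) + x * (y - x)" by (simp add: algebra_simps)
    then have "int p dvd y * y" using that N by (metis dvd_add dvd_mult2)
    then show ?thesis using pp prime_dvd_mult_iff by blast
  qed
  have "int p dvd x"
  proof (rule ccontr)
    assume nx: "\<not> int p dvd x"
    then have ny: "\<not> int p dvd y" using yx by blast
    define k where "k = p div 3"
    have pk: "p - 1 = 3 * k + 1" using p by (simp add: k_def) presburger
    have fermat: "[z ^ (p - 1) = 1] (mod int p)" if "\<not> int p dvd z" for z
    proof -
      have e: "[int (nat (z mod int p)) = z] (mod int p)" using p(1) by (simp add: prime_gt_0_nat cong_def)
      have "\<not> p dvd nat (z mod int p)"
        using that e p(1) by (metis cong_dvd_iff int_dvd_int_iff)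
      then have "[int (nat (z mod int p) ^ (p - 1)) = int 1] (mod int p)"
        using fermat_theorem[OF p(1)] cong_int_iff by blast
      moreover have "[int (nat (z mod int p)) ^ (p - 1) = z ^ (p - 1)] (mod int p)" using e by (rule cong_pow)
      ultimately show ?thesis by (metis cong_sym cong_trans of_nat_1 of_nat_power)
    qed
    have "[x ^ 3 = - (y ^ 3)] (mod int p)"
    proof -
      have "x ^ 3 - - (y ^ 3) = (x + y) * (x*x-x*y+y*y)" by (simp add: algebra_simps power3_eq_cube)
      then show ?thesis using N by (simp add: cong_iff_dvd_diff)
    qed
    then have "[(x ^ 3) ^ k * x = (- (y ^ 3)) ^ k * x] (mod int p)" by (intro cong_mult cong_pow) auto
    moreover have "(- (y ^ 3)) ^ k * x = y ^ (3 * k) * ((-1) ^ k * x)"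
      by (simp add: power_minus[of "y^3"] power_mult)
    moreover have "(x ^ 3) ^ k * x = x ^ (p - 1)" unfolding pk by (simp add: power_mult)
    moreover have "[x ^ (p - 1) = y ^ (p - 1)] (mod int p)"
      using fermat[OF nx] fermat[OF ny] cong_sym cong_trans by blast
    moreover have "y ^ (p - 1) = y ^ (3 * k) * y" unfolding pk by simp
    ultimately have "[y ^ (3 * k) * y = y ^ (3 * k) * ((-1) ^ k * x)] (mod int p)"
      by (metis cong_sym cong_trans)
    moreover have "Rings.coprime (y ^ (3 * k)) (int p)"
      using ny pp by (metis coprime_commute coprime_power_left_iff prime_imp_coprime)
    ultimately have "[y = (-1) ^ k * x] (mod int p)" using cong_mult_lcancel by blast
    then consider "[y = x] (mod int p)" | "[y = - x] (mod int p)" 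
      by (cases "even k") auto
    then show False
    proof cases
      case 1
      then have "int p dvd y - x" by (simp add: cong_iff_dvd_diff)
      moreover have "x * x = (x*x-x*y+y*y) - (y - x) * y" by (simp add: algebra_simps)
      ultimately have "int p dvd x * x" using N by (metis dvd_diff dvd_mult2)
      then show False using nx pp prime_dvd_mult_iff by blast
    next
      case 2
      then have "int p dvd y + x" by (simp add: cong_iff_dvd_diff)
      moreover have "3 * (x * x) = (x*x-x*y+y*y) - (y + x) * (y - 2 * x)" by (simp add: algebra_simps)
      ultimately have "int p dvd 3 * (x * x)" using N by (metis dvd_diff dvd_mult2)
      then show False using nx pp p3 prime_dvd_mult_iff by blast
    qed
  qed
  then show ?thesis using xy by (simp add: ab eis_dvd_def)
qed

text \<open>An element of norm \<open>p M\<close> is divisible by \<open>p\<close>, and the cofactor has norm \<open>M / p\<close>.\<close>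

lemma card_primary_of_norm_inert_prime:
  assumes p: "Factorial_Ring.prime (p::nat)" "p mod 3 = 2"
  shows "card (primary_of_norm (int p * M)) = (if int p dvd M then card (primary_of_norm (M div int p)) else 0)"
proof -
  have q: "[- int p = 1] (mod 3)" "- int p \<noteq> 0"
  proof -
    have "int p mod 3 = 2" using p(2) using zmod_int[of p 3] by simp
    then show "[- int p = 1] (mod 3)" by (simp add: cong_def zmod_zminus1_eq_if)
  next
    show "- int p \<noteq> 0" using prime_gt_0_nat[OF p(1)] by linarith
  qed
  have "eis_dvd (- int p) \<beta>" if "\<beta> \<in> primary_of_norm (int p * M)" for \<beta>
    using inert_prime_dvd[OF p, of \<beta>] that by (simp add: primary_of_norm_def eis_dvd_def case_prod_beta)
  then have e: "primary_of_norm (int p * M) = {\<beta> \<in> primary_of_norm (int p * M). eis_dvd (- int p) \<beta>}" by blast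
  have sq: "- int p * - int p = int p * int p" by simp
  have p0: "int p \<noteq> 0" using q by simp
  have "(int p * int p dvd int p * M) = (int p dvd M)" "int p * M div (int p * int p) = M div int p"
    using p0 by simp_all
  then show ?thesis using card_primary_of_norm_scalar_multiples[OF q, of "int p * M"]
    unfolding e[symmetric] sq by presburger
qed

section \<open>Counting primary elements whose norm is a cube\<close>

text \<open>A primitive root raised to the power \<open>(p - 1) / 3\<close> is a root of \<open>X\<^sup>3 - 1\<close> other than \<open>1\<close>, hence
a root of \<open>X\<^sup>2 + X + 1\<close>.\<close>

lemma cube_root_mod_prime:
  assumes p: "Factorial_Ring.prime (p::nat)" "p mod 3 = 1"
  obtains z :: int where "int p dvd z * z - z + 1"
proof -
  have p1: "p > 1" using p(1) prime_gt_1_nat by blast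
  obtain g where g: "residue_primroot p g" using prime_primitive_root_exists[OF p1] p(1) by auto
  then have og: "ord p g = p - 1" using p(1) by (simp add: residue_primroot_def totient_prime)
  define k where "k = (p - 1) div 3"
  have pk: "p - 1 = 3 * k" "k > 0" using p p1 unfolding k_def by presburger+
  have "[g ^ (3 * k) = 1] (mod p)" unfolding ord_divides og pk by simp
  then have "[int (g ^ (3 * k)) = int 1] (mod int p)" unfolding cong_int_iff .
  then have "int p dvd int g ^ (3 * k) - 1" by (simp add: cong_iff_dvd_diff)
  moreover have "int g ^ (3 * k) = (int g ^ k) ^ 3" by (simp add: power_mult mult.commute[of 3 k])
  ultimately have "int p dvd (int g ^ k - 1) * ((int g ^ k) * (int g ^ k) + int g ^ k + 1)"
    by (simp add: power3_eq_cube algebra_simps)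
  moreover have "\<not> int p dvd int g ^ k - 1"
  proof
    assume "int p dvd int g ^ k - 1"
    then have "[int (g ^ k) = int 1] (mod int p)" by (simp add: cong_iff_dvd_diff)
    then have "[g ^ k = 1] (mod p)" unfolding cong_int_iff .
    then have "3 * k dvd k" unfolding ord_divides og pk .
    then show False using pk(2) by (auto dest: dvd_imp_le)
  qed
  ultimately have "int p dvd (int g ^ k) * (int g ^ k) + int g ^ k + 1"
    using p(1) by (metis prime_dvd_mult_iff prime_nat_int_transfer)
  then show thesis using that[of "- (int g ^ k)"] by simp
qed

text \<open>With \<open>s = \<lfloor>\<surd>p\<rfloor>\<close> there are \<open>(s + 1)\<^sup>2 > p\<close> pairs with entries between \<open>0\<close> and \<open>s\<close>; two of
them have the same value \<open>x - z y\<close> modulo \<open>p\<close>, and their difference is as required.\<close>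

lemma Thue:
  fixes p :: nat and z :: int
  assumes "p > 0"
  obtains x y :: int where "int p dvd x - z * y" "(x, y) \<noteq> (0, 0)" "x * x \<le> int p" "y * y \<le> int p"
proof -
  define s where "s = floor_sqrt p"
  have s: "s * s \<le> p" "p < (s + 1) * (s + 1)"
    using floor_sqrt_power2_le[of p] Suc_floor_sqrt_power2_gt[of p] unfolding s_def by (simp_all only: power2_eq_square Suc_eq_plus1)
  define D where "D = {0..int s} \<times> {0..int s}"
  define f where "f = (\<lambda>(x, y). (x - z * y) mod int p)"
  have "f ` D \<subseteq> {0..<int p}" using assms by (auto simp: f_def)
  then have "card (f ` D) \<le> p" using card_mono[of "{0..<int p}" "f ` D"] by simp
  also have "p < card D" using s by (simp add: D_def nat_add_distrib)
  finally have "\<not> inj_on f D" by (rule pigeonhole)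
  then obtain a b c d where abcd: "(a, b) \<in> D" "(c, d) \<in> D" "f (a, b) = f (c, d)" "(a, b) \<noteq> (c, d)"
    by (auto simp: inj_on_def)
  have sm: "w * w \<le> int p" if "\<bar>w\<bar> \<le> int s" for w
  proof -
    have "\<bar>w\<bar> * \<bar>w\<bar> \<le> int s * int s" using that by (intro mult_mono) auto
    moreover have "int s * int s \<le> int p" using s(1) by (metis of_nat_le_iff of_nat_mult)
    ultimately show ?thesis by simp
  qed
  have "int p dvd (a - z * b) - (c - z * d)" using abcd(3) by (simp add: f_def mod_eq_dvd_iff)
  then have "int p dvd (a - c) - z * (b - d)" by (simp add: algebra_simps)
  then show thesis using abcd sm[of "a - c"] sm[of "b - d"] that[of "a - c" "b - d"] by (auto simp: D_def)
qed

text \<open>The units \<open>\<plusminus>1, \<plusminus>\<zeta>, \<plusminus>\<zeta>\<^sup>2\<close> act transitively on the classes modulo \<open>3\<close> whose norm is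
congruent to \<open>1\<close>; each case multiplies by the unit that leads to the class of \<open>1\<close>.\<close>

lemma primary_associate:
  assumes "[eis_norm \<beta> = 1] (mod 3)"
  obtains \<gamma> where "eis_norm \<gamma> = eis_norm \<beta>" "primary \<gamma>"
proof -
  obtain x y where b: "\<beta> = (x, y)" by (cases \<beta>)
  have n: "x * x - x * y + y * y = (x + y) * (x + y) - 3 * (x * y)" by (simp add: algebra_simps)
  have "\<not> 3 dvd x + y"
  proof
    assume "3 dvd x + y"
    then have "3 dvd (x + y) * (x + y) - 3 * (x * y)" by (intro dvd_diff dvd_mult dvd_triv_left)
    then have "3 dvd eis_norm \<beta>" by (simp add: b eis_norm_def n)
    then show False using assms by (simp add: cong_def dvd_eq_mod_eq_0)
  qed
  then have "y mod 3 = 0 \<and> x mod 3 = 1 \<or> y mod 3 = 0 \<and> (- x) mod 3 = 1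
    \<or> x mod 3 = 0 \<and> y mod 3 = 1 \<or> x mod 3 = 0 \<and> (-y) mod 3 = 1
    \<or> (x - y) mod 3 = 0 \<and> (-y) mod 3 = 1 \<or> (y - x) mod 3 = 0 \<and> y mod 3 = 1"
    by presburger
  then consider "y mod 3 = 0" "x mod 3 = 1" | "y mod 3 = 0" "(- x) mod 3 = 1"
    | "x mod 3 = 0" "y mod 3 = 1" | "x mod 3 = 0" "(-y) mod 3 = 1"
    | "(x - y) mod 3 = 0" "(-y) mod 3 = 1" | "(y - x) mod 3 = 0" "y mod 3 = 1"
    by blast
  then show thesis
  proof cases
    case 1 then show ?thesis using that[of "(x, y)"] by (simp add: b eis_norm_def primary_def cong_def)
  next
    case 2 then show ?thesis using that[of "(-x, -y)"] by (auto simp: b eis_norm_def primary_def cong_def zmod_zminus1_eq_if)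
  next
    case 3 
    then have "(y - x) mod 3 = 1" "(-x) mod 3 = 0" by presburger+
    then show ?thesis using that[of "(y - x, -x)"] by (simp add: b eis_norm_def primary_def cong_def algebra_simps)
  next
    case 4
    then have "(x - y) mod 3 = 1" by presburger
    with 4 show ?thesis using that[of "(x - y, x)"] by (simp add: b eis_norm_def primary_def cong_def algebra_simps)
  next
    case 5 then show ?thesis using that[of "(- y, x - y)"] by (simp add: b eis_norm_def primary_def cong_def algebra_simps)
  next
    case 6 then show ?thesis using that[of "(y, y - x)"] by (simp add: b eis_norm_def primary_def cong_def algebra_simps)
  qed
qed

text \<open>By Thue's lemma some norm is a multiple of \<open>p\<close> strictly between \<open>0\<close> and \<open>3 p\<close>. It is not \<open>2 p\<close>, because
an even norm is divisible by \<open>4\<close>.\<close>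

lemma split_prime_is_norm:
  assumes p: "Factorial_Ring.prime (p::nat)" "p mod 3 = 1"
  obtains \<pi> where "\<pi> \<in> primary_of_norm (int p)"
proof -
  obtain z where z: "int p dvd z * z - z + 1" using cube_root_mod_prime[OF p] .
  obtain x y where xy: "int p dvd x - z * y" "(x, y) \<noteq> (0, 0)" "x * x \<le> int p" "y * y \<le> int p"
    using Thue[of p z] prime_gt_0_nat[OF p(1)] by blast
  \<comment> \<open>a prime is no square, so the bounds from the lemma of Thue are strict\<close>
  have nosq: "w * w \<noteq> int p" for w
  proof
    assume w: "w * w = int p"
    have "int p dvd w * w" by (simp add: w)
    then have "int p dvd w" using p(1) by (metis prime_dvd_mult_iff prime_nat_int_transfer)
    then obtain c where "w = int p * c" by blast
    then have "int p * (int p * (c * c)) = int p * 1" using w by (simp add: algebra_simps)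
    then have "int p * (c * c) = 1" using prime_gt_0_nat[OF p(1)] by (metis mult_left_cancel of_nat_0_less_iff less_irrefl)
    then show False using prime_gt_1_nat[OF p(1)] by (simp add: zmult_eq_1_iff)
  qed
  define N where "N = eis_norm (x, y)"
  have N4: "4 * N = (2*x-y)*(2*x-y) + 3*(y*y)" "4 * N = (2*y-x)*(2*y-x) + 3*(x*x)"
    by (simp_all add: N_def eis_norm_def algebra_simps)
  have "N = (x - z*y)*(x + z*y - y) + y*y*(z*z-z+1)" by (simp add: N_def eis_norm_def algebra_simps)
  then have "int p dvd N" using xy z by (metis dvd_add dvd_mult dvd_mult2)
  then obtain k where k: "N = int p * k" by blast
  have lt: "x * x < int p" "y * y < int p" using nosq[of x] nosq[of y] xy by linarith+
  have "N > 0"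
  proof -
    have "x * x > 0 \<or> y * y > 0" using xy(2) by (auto simp: zero_less_mult_iff)
    then show ?thesis using N4 zero_le_square[of "2*x-y"] zero_le_square[of "2*y-x"] by linarith
  qed
  have "N < 3 * int p"
  proof -
    have "2 * N = 3 * (x*x) + 3*(y*y) - (x + y)*(x+y)" by (simp add: N_def eis_norm_def algebra_simps)
    then show ?thesis using lt zero_le_square[of "x+y"] by linarith
  qed
  have "k > 0" using \<open>N > 0\<close> by (simp add: k zero_less_mult_iff)
  have "k < 3" using \<open>N < 3 * int p\<close> prime_gt_0_nat[OF p(1)] by (simp add: k)
  have "k \<noteq> 2"
  proof
    assume "k = 2"
    then have e: "x*x - x*y + y*y = 2 * int p" using k by (simp add: N_def eis_norm_def)
    then have "even (x*x - x*y + y*y)" by simp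
    then have "even x" "even y" by auto
    then obtain a b where ab: "x = 2 * a" "y = 2 * b" by (auto elim!: evenE)
    have "int p = 2 * (a*a-a*b+b*b)" using e unfolding ab by (simp add: algebra_simps)
    then have "even (int p)" by simp
    then have "even p" by simp
    then have "p = 2" using prime_odd_nat[OF p(1)] prime_ge_2_nat[OF p(1)] by linarith
    then show False using p(2) by simp
  qed
  then have "N = int p" using \<open>k > 0\<close> \<open>k < 3\<close> k by auto
  moreover have "[int p = 1] (mod 3)" using p(2) zmod_int[of p 3] by (simp add: cong_def)
  ultimately obtain \<gamma> where "eis_norm \<gamma> = int p" "primary \<gamma>"
    using primary_associate[of "(x, y)"] N_def by metis
  then show thesis using that[of \<gamma>] by (simp add: primary_of_norm_def)
qed

text \<open>By the recursion the counts for \<open>e = 0, 1, 2, \<dots>\<close> form an arithmetic progression.\<close>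

lemma card_primary_of_norm_split_prime_power:
  assumes p: "Factorial_Ring.prime (p::nat)" "p mod 3 = 1" and m: "\<not> p dvd m"
  shows "card (primary_of_norm (int (p ^ e * m))) = (e + 1) * card (primary_of_norm (int m))"
proof -
  obtain \<pi> where \<pi>: "\<pi> \<in> primary_of_norm (int p)" using split_prime_is_norm[OF p] .
  have ip: "Factorial_Ring.prime (int p)" "[int p = 1] (mod 3)"
    using p zmod_int[of p 3] by (simp_all add: cong_def)
  have p0: "p > 0" using p(1) prime_gt_0_nat by blast
  note rec = card_primary_of_norm_split_prime[OF ip \<pi>]
  show ?thesis
  proof (induction e rule: less_induct)
    case (less e)
    consider "e = 0" | "e = 1" | e' where "e = Suc (Suc e')"
      by (cases e; cases "e - 1") auto
    then show ?case
    proof cases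
      case 1 then show ?thesis by simp
    next
      case 2
      have "\<not> int p dvd int m" using m by simp
      then show ?thesis using rec[of "int m"] 2 by simp
    next
      case 3
      have M: "int (p ^ e * m) = int p * int (p ^ Suc e' * m)" "int (p ^ Suc e' * m) = int p * int (p ^ e' * m)"
        by (simp_all add: 3)
      have "int p dvd int (p ^ Suc e' * m)" "int (p ^ Suc e' * m) div int p = int (p ^ e' * m)"
        unfolding M(2) using p0 by simp_all
      then have "card (primary_of_norm (int (p ^ e * m))) + card (primary_of_norm (int (p ^ e' * m))) = 2 * card (primary_of_norm (int (p ^ Suc e' * m)))"
        using rec[of "int (p ^ Suc e' * m)"] unfolding M(1) by presburger
      then show ?thesis using less[of e'] less[of "Suc e'"] 3 by (simp add: algebra_simps)
    qed
  qed
qed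

lemma card_primary_of_norm_inert_prime_power:
  assumes p: "Factorial_Ring.prime (p::nat)" "p mod 3 = 2" and m: "\<not> p dvd m"
  shows "card (primary_of_norm (int (p ^ e * m))) = (if even e then card (primary_of_norm (int m)) else 0)"
proof -
  have p0: "p > 0" using p(1) prime_gt_0_nat by blast
  note rec = card_primary_of_norm_inert_prime[OF p]
  show ?thesis
  proof (induction e rule: less_induct)
    case (less e)
    consider "e = 0" | "e = 1" | e' where "e = Suc (Suc e')"
      by (cases e; cases "e - 1") auto
    then show ?case
    proof cases
      case 1 then show ?thesis by simp
    next
      case 2
      have "\<not> int p dvd int m" using m by simp
      then show ?thesis using rec[of "int m"] 2 by simp
    next
      case 3
      have M: "int (p ^ e * m) = int p * int (p ^ Suc e' * m)" "int (p ^ Suc e' * m) = int p * int (p ^ e' * m)"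
        by (simp_all add: 3)
      have "int p dvd int (p ^ Suc e' * m)" "int (p ^ Suc e' * m) div int p = int (p ^ e' * m)"
        unfolding M(2) using p0 by simp_all
      then have "card (primary_of_norm (int (p ^ e * m))) = card (primary_of_norm (int (p ^ e' * m)))"
        using rec[of "int (p ^ Suc e' * m)"] unfolding M(1) by presburger
      then show ?thesis using less[of e'] 3 by simp
    qed
  qed
qed

lemma primary_of_norm_1: "primary_of_norm 1 = {(1, 0)}"
proof (intro equalityI subsetI)
  fix \<beta> assume b: "\<beta> \<in> primary_of_norm 1"
  obtain x y where xy: "\<beta> = (x, y)" by (cases \<beta>)
  have n: "x*x-x*y+y*y = 1" and c: "[x = 1] (mod 3)" "[y = 0] (mod 3)" using b by (auto simp: xy primary_of_norm_def eis_norm_def primary_def)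
  have "4 = (2*x-y)*(2*x-y) + 3*(y*y)" using n by (simp add: algebra_simps)
  then have "y * y < 2" using zero_le_square[of "2*x-y"] by linarith
  moreover have "y * y \<ge> 9" if "y \<noteq> 0"
  proof -
    have "\<bar>y\<bar> \<ge> 3" using c(2) that dvd_imp_le_int[of y 3] by (simp add: cong_0_iff)
    then have "\<bar>y\<bar> * \<bar>y\<bar> \<ge> 3 * 3" by (intro mult_mono) auto
    then show ?thesis by simp
  qed
  ultimately have "y = 0" by force
  then have "x = 1 \<or> x = -1" using n by (simp add: zmult_eq_1_iff) 
  then show "\<beta> \<in> {(1, 0)}" using c \<open>y = 0\<close> xy by (auto simp: cong_def)
qed (simp add: primary_of_norm_def eis_norm_def primary_def)

lemma finite_divisors_with: "d > 0 \<Longrightarrow> finite {e. e dvd d \<and> Q e}" for d :: nat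
  using finite_subset[OF _ finite_divisors_nat[of d], of "{e. e dvd d \<and> Q e}"] by blast

lemma P_mem:
  assumes "d > 0"
  shows "P j d \<in> {e. e dvd d \<and> (\<forall>p. Factorial_Ring.prime p \<and> p dvd e \<longrightarrow> p mod 3 = j mod 3)}"
proof -
  have "1 \<in> {e. e dvd d \<and> (\<forall>p. Factorial_Ring.prime p \<and> p dvd e \<longrightarrow> p mod 3 = j mod 3)}"
    by simp
  then show ?thesis unfolding P_def by (intro Max_in finite_divisors_with assms) blast
qed

lemma P_dvd: "d > 0 \<Longrightarrow> P j d dvd d"
  using P_mem by blast

text \<open>\<open>P j\<close> is multiplicative because divisors of \<open>p\<^sup>i m\<close> factor into a divisor of \<open>p\<^sup>i\<close> and one of \<open>m\<close>; the
prime \<open>p\<close> contributes all of \<open>p\<^sup>i\<close> or nothing.\<close>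

lemma P_prime_power_mult:
  assumes p: "Factorial_Ring.prime (p::nat)" "m > 0"
  shows "P j (p ^ i * m) = (if p mod 3 = j mod 3 then p ^ i else 1) * P j m"
proof -
  define S where "S d = {e. e dvd d \<and> (\<forall>p. Factorial_Ring.prime p \<and> p dvd e \<longrightarrow> p mod 3 = j mod 3)}" for d
  have S: "P j d = Max (S d)" for d unfolding P_def S_def ..
  have fin: "finite (S d)" if "d > 0" for d
    unfolding S_def by (rule finite_divisors_with[OF that])
  define c where "c = (if p mod 3 = j mod 3 then p ^ i else 1)"
  have pm: "p ^ i * m > 0" using p prime_gt_0_nat by auto
  have Pm: "P j m \<in> S m" using P_mem[OF p(2)] unfolding S_def .
  have "Max (S (p ^ i * m)) = c * P j m"
  proof (rule Max_eqI[OF fin[OF pm]])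
    fix e assume e: "e \<in> S (p ^ i * m)"
    then obtain b d where bd: "e = b * d" "b dvd p ^ i" "d dvd m"
      unfolding S_def using division_decomp by blast
    have "d \<in> S m" using e bd unfolding S_def by auto
    then have "d \<le> P j m" unfolding S using fin[OF p(2)] by simp
    moreover have "b \<le> c"
    proof (cases "p mod 3 = j mod 3")
      case True then show ?thesis using bd(2) p(1) prime_gt_0_nat by (auto simp: c_def dvd_imp_le)
    next
      case False
      obtain k where k: "b = p ^ k" using bd(2) divides_primepow_nat[OF p(1)] by blast
      have "\<not> p dvd b" using e bd(1) False p(1) unfolding S_def by auto
      then have "k = 0" using k by (cases k) auto
      then show ?thesis using k False by (simp add: c_def)
    qed
    ultimately show "e \<le> c * P j m" using bd(1) by (simp add: mult_mono)
  next
    have "q mod 3 = j mod 3" if "Factorial_Ring.prime q" "q dvd c * P j m" for q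
    proof -
      have "q dvd c \<or> q dvd P j m" using that prime_dvd_mult_iff by blast
      then show ?thesis
      proof
        assume "q dvd c"
        then have "q dvd p \<and> p mod 3 = j mod 3" using that(1) prime_dvd_power by (auto simp: c_def split: if_splits)
        then show ?thesis using that(1) p(1) primes_dvd_imp_eq by blast
      next
        assume "q dvd P j m"
        then show ?thesis using Pm that(1) unfolding S_def by blast
      qed
    qed
    moreover have "c * P j m dvd p ^ i * m"
      using Pm unfolding S_def c_def by (auto intro: mult_dvd_mono)
    ultimately show "c * P j m \<in> S (p ^ i * m)" unfolding S_def by blast
  qed
  then show ?thesis unfolding S c_def .
qed

definition divisor_weight :: "nat \<Rightarrow> real" where
  "divisor_weight d = 3 ^ \<omega> (P 1 d) * (-1) ^ \<Omega> (P 2 d)"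

lemma divisor_weight_prime_power_mult:
  assumes p: "Factorial_Ring.prime (p::nat)" "\<not> p dvd m" "m > 0"
  shows "p mod 3 = 1 \<Longrightarrow> divisor_weight (p ^ i * m) = (if i = 0 then 1 else 3) * divisor_weight m"
    and "p mod 3 = 2 \<Longrightarrow> divisor_weight (p ^ i * m) = (-1) ^ i * divisor_weight m"
proof -
  have pd: "\<not> p dvd P j m" "P j m \<noteq> 0" for j
  proof -
    show "\<not> p dvd P j m" using P_dvd[OF p(3)] p(2) dvd_trans by blast
    then show "P j m \<noteq> 0" by (metis dvd_0_right)
  qed
  have p0: "p ^ i \<noteq> 0" using p(1) by auto
  show "divisor_weight (p ^ i * m) = (if i = 0 then 1 else 3) * divisor_weight m" if "p mod 3 = 1"
  proof (cases "i = 0")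
    case False
    have "prime_factors (p ^ i * P 1 m) = insert p (prime_factors (P 1 m))"
      using False p(1) p0 pd by (simp add: prime_factorization_mult prime_factorization_prime_power)
    moreover have "p \<notin> prime_factors (P 1 m)" using pd(1) in_prime_factors_imp_dvd by blast
    ultimately have "\<omega> (p ^ i * P 1 m) = Suc (\<omega> (P 1 m))" by (simp add: \<omega>_def)
    then show ?thesis using that False by (simp add: divisor_weight_def P_prime_power_mult[OF p(1,3)])
  qed simp
  show "divisor_weight (p ^ i * m) = (-1) ^ i * divisor_weight m" if "p mod 3 = 2"
  proof -
    have "\<Omega> (p ^ i * P 2 m) = i + \<Omega> (P 2 m)"
      using p(1) p0 pd by (simp add: \<Omega>_def prime_factorization_mult prime_factorization_prime_power)
    then show ?thesis using that by (simp add: divisor_weight_def P_prime_power_mult[OF p(1,3)] power_add)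
  qed
qed

lemma sum_divisors_prime_power_mult:
  fixes g :: "nat \<Rightarrow> real"
  assumes p: "Factorial_Ring.prime (p::nat)" "\<not> p dvd m" "m > 0"
    and g: "\<And>i d. d dvd m \<Longrightarrow> g (p ^ i * d) = c i * g d"
  shows "(\<Sum>d | d dvd p ^ e * m. g d) = (\<Sum>i\<le>e. c i) * (\<Sum>d | d dvd m. g d)"
proof -
  let ?h = "\<lambda>(i, d). p ^ i * d"
  have img: "{d. d dvd p ^ e * m} = ?h ` ({..e} \<times> {d. d dvd m})"
  proof (intro equalityI subsetI)
    fix d assume "d \<in> {d. d dvd p ^ e * m}"
    then obtain b c where bc: "d = b * c" "b dvd p ^ e" "c dvd m" using division_decomp by blast
    then obtain i where "i \<le> e" "b = p ^ i" using divides_primepow_nat[OF p(1)] by blast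
    then show "d \<in> ?h ` ({..e} \<times> {d. d dvd m})" using bc by auto
  qed (auto intro: mult_dvd_mono le_imp_power_dvd)
  have inj: "inj_on ?h ({..e} \<times> {d. d dvd m})"
  proof (rule inj_onI)
    fix s t assume st: "s \<in> {..e} \<times> {d. d dvd m}" "t \<in> {..e} \<times> {d. d dvd m}" "?h s = ?h t"
    obtain i d i' d' where s: "s = (i, d)" "t = (i', d')" by (cases s; cases t)
    have "\<not> p dvd d" "\<not> p dvd d'" using st s p(2) dvd_trans by auto
    then show "s = t" using st(3) s prime_power_cancel2[OF p(1), of d i d' i'] by (auto simp: mult.commute)
  qed
  have "(\<Sum>d | d dvd p ^ e * m. g d) = (\<Sum>(i, d)\<in>{..e} \<times> {d. d dvd m}. g (p ^ i * d))"
    unfolding img sum.reindex[OF inj] by (simp add: case_prod_beta)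
  also have "\<dots> = (\<Sum>(i, d)\<in>{..e} \<times> {d. d dvd m}. c i * g d)"
    by (rule sum.cong) (auto simp: g)
  also have "\<dots> = (\<Sum>i\<le>e. c i) * (\<Sum>d | d dvd m. g d)"
    by (simp add: sum_product sum.cartesian_product)
  finally show ?thesis .
qed

text \<open>Both sides change by the same factor when \<open>n\<close> is multiplied by a power \<open>p\<^sup>e\<close> of a new prime. The factor is
\<open>3 e + 1\<close> for \<open>p \<equiv> 1\<close> modulo \<open>3\<close>, on the right as \<open>1 + 3 + \<dots> + 3\<close>; for \<open>p \<equiv> 2\<close> it is \<open>1\<close> or \<open>0\<close> according to the parity of
\<open>e\<close>, on the right as \<open>1 - 1 + \<dots> \<plusminus> 1\<close>.\<close>

lemma card_primary_of_norm_cube: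
  assumes "n > 0" "\<not> 3 dvd (n::nat)"
  shows "real (card (primary_of_norm (int (n ^ 3)))) = (\<Sum>d | d dvd n. divisor_weight d)"
  using assms
proof (induction n rule: less_induct)
  case (less n)
  show ?case
  proof (cases "n = 1")
    case True
    have "P j 1 = 1" for j using P_dvd[of 1 j] by simp
    then have "divisor_weight 1 = 1" by (simp add: divisor_weight_def \<omega>_def \<Omega>_def)
    then show ?thesis using True by (simp add: primary_of_norm_1)
  next
    case False
    then obtain p where p: "Factorial_Ring.prime p" "p dvd n" using prime_factor_nat by blast
    define e where "e = multiplicity p n"
    have "n \<noteq> 0" "\<not> is_unit p" using less.prems p(1) not_prime_unit by auto
    then obtain m where nm: "n = p ^ e * m" "\<not> p dvd m"
      unfolding e_def by (rule multiplicity_decompose')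
    have m0: "m > 0" using nm by (cases m) auto
    have e0: "e > 0" using nm p(2) by (cases e) auto
    have "m < n" using nm(1) m0 e0 prime_gt_1_nat[OF p(1)] one_less_power[of p e] by simp
    moreover have "\<not> 3 dvd m" using less.prems(2) nm(1) by auto
    ultimately have IH: "real (card (primary_of_norm (int (m ^ 3)))) = (\<Sum>d | d dvd m. divisor_weight d)"
      using less.IH m0 by blast
    have n3: "n ^ 3 = p ^ (3 * e) * m ^ 3" by (simp add: nm(1) power_mult_distrib power_mult mult.commute[of 3])
    have pm3: "\<not> p dvd m ^ 3" using nm(2) p(1) prime_dvd_power by blast
    have dm: "\<not> p dvd d" "d > 0" if "d dvd m" for d using that nm(2) m0 dvd_trans by auto
    have "p mod 3 \<noteq> 0" using less.prems(2) p by (metis dvd_eq_mod_eq_0 dvd_trans)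
    then consider "p mod 3 = 1" | "p mod 3 = 2" by linarith
    then show ?thesis
    proof cases
      case 1
      have "(\<Sum>i\<le>e. if i = 0 then 1 else 3::real) = 1 + 3 * real e" by (induction e) auto
      then have "(\<Sum>d | d dvd n. divisor_weight d) = (1 + 3 * real e) * (\<Sum>d | d dvd m. divisor_weight d)"
        unfolding nm(1)
        using sum_divisors_prime_power_mult[OF p(1) nm(2) m0, of divisor_weight "\<lambda>i. if i = 0 then 1 else 3" e]
          divisor_weight_prime_power_mult(1)[OF p(1) dm 1] by simp
      then show ?thesis unfolding n3 card_primary_of_norm_split_prime_power[OF p(1) 1 pm3] IH[symmetric] by (simp add: distrib_right)
    next
      case 2
      have "(\<Sum>i\<le>e. (-1) ^ i :: real) = (if even e then 1 else 0)" by (induction e) auto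
      then have "(\<Sum>d | d dvd n. divisor_weight d) = (if even e then 1 else 0) * (\<Sum>d | d dvd m. divisor_weight d)"
        unfolding nm(1)
        using sum_divisors_prime_power_mult[OF p(1) nm(2) m0, of divisor_weight "\<lambda>i. (-1) ^ i" e]
          divisor_weight_prime_power_mult(2)[OF p(1) dm 2] by simp
      then show ?thesis unfolding n3 card_primary_of_norm_inert_prime_power[OF p(1) 2 pm3] IH[symmetric] by simp
    qed
  qed
qed

section \<open>Cubics with square discriminant and points of the ellipse\<close>

text \<open>The polynomial \<open>t\<^sup>3 - t\<^sup>2 + a t + b\<close> has discriminant \<open>(4 (1 - 3 a)\<^sup>3 - (27 b + 9 a - 2)\<^sup>2) / 27\<close>, so this is the set
of the pairs \<open>(b, k)\<close> such that the discriminant is \<open>k\<^sup>2\<close>.\<close>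

definition square_disc :: "int \<Rightarrow> (int \<times> int) set" where
  "square_disc a = {(b, k). (27 * b + 9 * a - 2) ^ 2 + 27 * k ^ 2 = 4 * (1 - 3 * a) ^ 3}"

definition has_int_root :: "int \<Rightarrow> int \<Rightarrow> bool" where
  "has_int_root a b \<longleftrightarrow> (\<exists>x. x ^ 3 - x ^ 2 + a * x + b = 0)"

text \<open>If \<open>z = 1 - x - y\<close>, the equation says that \<open>x y + y z + z x = a\<close>: the roots of a cubic, two of them listed in
order.\<close>

definition root_pairs :: "int \<Rightarrow> (int \<times> int) set" where
  "root_pairs a = {(x, y). x ^ 2 + y ^ 2 + x * y - x - y = - a}"

text \<open>With \<open>m = 27 b + 9 a - 2\<close>, four times the norm of \<open>x + 3 k \<zeta>\<close> is \<open>(2 x - 3 k)\<^sup>2 + 27 k\<^sup>2\<close>, so \<open>m = 3 k - 2 x\<close> matches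
the two equations; the sign is chosen so that \<open>x \<equiv> 1\<close> modulo \<open>3\<close>. Conversely, the equation determines \<open>m\<close> modulo \<open>27\<close> up to
sign, and \<open>x \<equiv> 1\<close> singles out the sign for which \<open>b\<close> is an integer.\<close>

lemma bij_square_disc:
  "bij_betw (\<lambda>(b, k). ((3 * k - (27 * b + 9 * a - 2)) div 2, 3 * k)) (square_disc a) (primary_of_norm ((1 - 3 * a) ^ 3))"
    (is "bij_betw ?h _ _")
proof (rule bij_betw_imageI)
  have ev: "even (3 * k - (27 * b + 9 * a - 2))" if "(b, k) \<in> square_disc a" for b k
  proof -
    have "even ((27 * b + 9 * a - 2) ^ 2 + 27 * k ^ 2)" using that by (simp add: square_disc_def)
    then show ?thesis by auto
  qed
  show "inj_on ?h (square_disc a)"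
  proof (rule inj_onI)
    fix s t assume st: "s \<in> square_disc a" "t \<in> square_disc a" "?h s = ?h t"
    obtain b k b' k' where s: "s = (b, k)" "t = (b', k')" by (cases s; cases t)
    have "k = k'" using st(3) s by simp
    moreover have "3 * k - (27 * b + 9 * a - 2) = 3 * k' - (27 * b' + 9 * a - 2)"
      using st ev[of b k] ev[of b' k'] unfolding s by (auto elim!: evenE)
    ultimately show "s = t" using s by simp
  qed
  show "?h ` square_disc a = primary_of_norm ((1 - 3 * a) ^ 3)"
  proof (intro equalityI subsetI)
    fix \<beta> assume "\<beta> \<in> ?h ` square_disc a"
    then obtain b k where bk: "(b, k) \<in> square_disc a" "\<beta> = ?h (b, k)" by auto
    obtain x where x: "3 * k - (27 * b + 9 * a - 2) = 2 * x" using ev[OF bk(1)] by blast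
    have m: "27 * b + 9 * a - 2 = 3 * k - 2 * x" using x by simp
    have "(3 * k - 2 * x) ^ 2 + 27 * k ^ 2 = 4 * (1 - 3 * a) ^ 3"
      using bk(1) unfolding square_disc_def m[symmetric] by simp
    then have "eis_norm (x, 3 * k) = (1 - 3 * a) ^ 3"
      by (simp add: eis_norm_def power2_eq_square algebra_simps)
    moreover have "x mod 3 = 1" using m by presburger
    ultimately show "\<beta> \<in> primary_of_norm ((1 - 3 * a) ^ 3)"
      using bk(2) x by (simp add: primary_of_norm_def primary_def cong_def)
  next
    fix \<beta> assume b: "\<beta> \<in> primary_of_norm ((1 - 3 * a) ^ 3)"
    obtain x y where xy: "\<beta> = (x, y)" by (cases \<beta>)
    have n: "x*x - x*y + y*y = (1 - 3 * a) ^ 3" and c: "x mod 3 = 1" "y mod 3 = 0"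
      using b by (auto simp: xy primary_of_norm_def eis_norm_def primary_def cong_def)
    obtain k where k: "y = 3 * k" using c(2) by (auto simp: dvd_eq_mod_eq_0[symmetric] elim!: dvdE)
    define m where "m = 3 * k - 2 * x"
    have mk: "m ^ 2 + 27 * k ^ 2 = 4 * (1 - 3 * a) ^ 3"
      unfolding n[symmetric] k m_def by (simp add: power2_eq_square algebra_simps)
    have "(m - (9 * a - 2)) * (m + (9 * a - 2)) = 27 * (a^2 - 4 * a ^ 3 - k ^ 2)"
      using mk by (simp add: power2_eq_square power3_eq_cube algebra_simps)
    then have d: "27 dvd (m - (9 * a - 2)) * (m + (9 * a - 2))" by simp
    have "(m + (9 * a - 2)) mod 3 = 2" using c(1) unfolding m_def by presburger
    then have "\<not> 3 dvd m + (9 * a - 2)" by presburger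
    then have "Rings.coprime (3::int) (m + (9 * a - 2))" by (intro prime_imp_coprime) auto
    then have "Rings.coprime (3 ^ 3 :: int) (m + (9 * a - 2))" by (rule coprime_power_left_iff[THEN iffD2, OF disjI1])
    then have "27 dvd m - (9 * a - 2)" using d by (simp add: coprime_dvd_mult_left_iff)
    then obtain b where b: "m = 27 * b + 9 * a - 2" by (auto elim!: dvdE simp: algebra_simps)
    have "(b, k) \<in> square_disc a" using mk unfolding b square_disc_def by simp
    moreover have "?h (b, k) = \<beta>" unfolding xy k using b m_def by simp
    ultimately show "\<beta> \<in> ?h ` square_disc a" by (intro image_eqI[of \<beta> ?h "(b, k)"]) simp_all
  qed
qed

text \<open>A vanishing discriminant means \<open>m\<^sup>2 = 4 n\<^sup>3\<close>, which forces \<open>n = s\<^sup>2\<close> and \<open>m = 2 s\<^sup>3\<close>. Then \<open>s\<close> is a (double)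
root of the reduced cubic \<open>X\<^sup>3 - 3 n X + m\<close>, and \<open>(s + 1) / 3\<close> is the corresponding root of the original one.\<close>

lemma square_disc_0_has_int_root:
  assumes "(b, 0) \<in> square_disc a"
  shows "has_int_root a b"
proof -
  define n where "n = 1 - 3 * a"
  define m where "m = 27 * b + 9 * a - 2"
  have e: "m ^ 2 = 4 * n ^ 3" using assms by (simp add: square_disc_def n_def m_def)
  then have "even (m ^ 2)" by simp
  then have "even m" by simp
  then obtain l where l: "m = 2 * l" by blast
  have ln: "l ^ 2 = n ^ 3" using e by (simp add: l power_mult_distrib)
  then have "n ^ 2 dvd l ^ 2" by (simp add: le_imp_power_dvd)
  then have "n dvd l" by simp
  then obtain s where s: "l = n * s" by blast
  have "n \<noteq> 0" unfolding n_def by presburger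
  then have ns: "n = s ^ 2" using ln by (simp add: s power_mult_distrib power3_eq_cube power2_eq_square)
  have ms: "m = 2 * s ^ 3" by (simp add: l s ns power3_eq_cube power2_eq_square)
  have m3: "(2 * s ^ 3) mod 3 = 1" unfolding ms[symmetric] m_def by presburger
  define t where "t = s div 3"
  have "s = 3 * t \<or> s = 3 * t + 1 \<or> s = 3 * t + 2" unfolding t_def by presburger
  moreover have "s \<noteq> 3 * t"
  proof
    assume "s = 3 * t"
    then have "2 * s ^ 3 = 3 * (18 * t ^ 3)" by (simp add: power3_eq_cube)
    with m3 show False by presburger
  qed
  moreover have "s \<noteq> 3 * t + 1"
  proof
    assume "s = 3 * t + 1"
    then have "2 * s ^ 3 = 3 * (18 * t ^ 3 + 18 * t ^ 2 + 6 * t) + 2"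
      by (simp add: power3_eq_cube power2_eq_square algebra_simps)
    with m3 show False by presburger
  qed
  ultimately have "s = 3 * t + 2" by blast
  then have "3 dvd s + 1" by presburger
  then obtain t where "s + 1 = 3 * t" by blast
  then have t: "s = 3 * t - 1" by simp
  have a: "3 * a = 1 - s ^ 2" using ns n_def by simp
  have b: "27 * b = 2 * s ^ 3 - 9 * a + 2" using ms m_def by simp
  have "27 * (t ^ 3 - t ^ 2 + a * t + b) = 27 * t ^ 3 - 27 * t ^ 2 + 9 * (3 * a) * t + 27 * b"
    by (simp add: algebra_simps)
  also have "\<dots> = 27 * t ^ 3 - 27 * t ^ 2 + 9 * (1 - s ^ 2) * t + (2 * s ^ 3 - 3 * (1 - s ^ 2) + 2)"
    unfolding b using a by simp
  also have "\<dots> = 0" unfolding t by (simp add: power2_eq_square power3_eq_cube algebra_simps)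
  finally show ?thesis unfolding has_int_root_def by (metis mult_eq_0_iff zero_neq_numeral)
qed

text \<open>The second component is the square root of the discriminant that belongs to the ordering \<open>(x, y, z)\<close> of
the roots; it changes sign under transpositions and is invariant under rotations.\<close>

definition root_pair_disc :: "int \<times> int \<Rightarrow> int \<times> int" where
  "root_pair_disc = (\<lambda>(x, y). let z = 1 - x - y in (- x * y * z, (x - y) * (y - z) * (z - x)))"

lemma root_pair_disc_in:
  assumes "s \<in> root_pairs a"
  shows "root_pair_disc s \<in> {(b, k) \<in> square_disc a. has_int_root a b}"
proof -
  obtain x y where s: "s = (x, y)" by (cases s)
  have a: "a = - (x ^ 2 + y ^ 2 + x * y - x - y)" using assms by (simp add: s root_pairs_def)
  have "root_pair_disc s \<in> square_disc a"
    unfolding s a by (simp add: root_pair_disc_def square_disc_def Let_def power2_eq_square power3_eq_cube algebra_simps)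
  moreover have "has_int_root a (- x * y * (1 - x - y))"
    unfolding has_int_root_def a
    by (intro exI[of _ x]) (simp add: power2_eq_square power3_eq_cube algebra_simps)
  ultimately show ?thesis by (simp add: s root_pair_disc_def Let_def)
qed

text \<open>Splitting off the integer root \<open>x\<close> leaves a quadratic of discriminant \<open>\<Delta>\<close>, and the discriminant \<open>k\<^sup>2\<close> of the cubic is
\<open>\<Delta> D\<^sup>2\<close>, where \<open>D\<close> is the derivative at \<open>x\<close>. If \<open>D \<noteq> 0\<close>, then \<open>\<Delta>\<close> is a square because \<open>k\<^sup>2\<close> is; if \<open>D = 0\<close>, then \<open>x\<close> is a
double root. In both cases the other roots are integers as well, and ordering them suitably gives the sign of \<open>k\<close>.\<close>

lemma root_pair_disc_surj:
  assumes bk: "(b, k) \<in> square_disc a" and red: "has_int_root a b"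
  shows "(b, k) \<in> root_pair_disc ` root_pairs a"
proof -
  obtain x where x: "x ^ 3 - x ^ 2 + a * x + b = 0" using red by (auto simp: has_int_root_def)
  then have b: "b = - (x ^ 3) + x ^ 2 - a * x" by simp
  \<comment> \<open>derivative at \<open>x\<close>, and discriminant of the quadratic cofactor\<close>
  define D where "D = 3 * x ^ 2 - 2 * x + a"
  define \<Delta> where "\<Delta> = (x - 1) ^ 2 - 4 * (a + x * (x - 1))"
  have "27 * k ^ 2 = 4 * (1 - 3 * a) ^ 3 - (27 * b + 9 * a - 2) ^ 2"
    using bk by (simp add: square_disc_def)
  also have "\<dots> = 27 * (\<Delta> * D ^ 2)"
    unfolding b \<Delta>_def D_def by (simp add: power2_eq_square power3_eq_cube algebra_simps)
  finally have k2: "k ^ 2 = \<Delta> * D ^ 2" by simp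
  have "\<exists>w. \<Delta> = w ^ 2"
  proof (cases "D = 0")
    case True
    then have "\<Delta> = (3 * x - 1) ^ 2" unfolding \<Delta>_def D_def
      by (simp add: power2_eq_square algebra_simps)
    then show ?thesis by blast
  next
    case False
    have "D ^ 2 dvd k ^ 2" using k2 by simp
    then have "D dvd k" by simp
    then obtain w where "k = D * w" by blast
    then have "\<Delta> = w ^ 2" using k2 False by (simp add: power_mult_distrib)
    then show ?thesis by blast
  qed
  then obtain w where w: "\<Delta> = w ^ 2" by blast
  have "even (w ^ 2 - (x - 1) ^ 2)" unfolding w[symmetric] \<Delta>_def by simp
  then have "even (1 - x + w)" by auto
  then obtain y where "1 - x + w = 2 * y" by blast
  then have wy: "w = 2 * y + x - 1" by simp
  have "4 * (x ^ 2 + y ^ 2 + x * y - x - y + a) = w ^ 2 - \<Delta>"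
    unfolding \<Delta>_def wy by (simp add: power2_eq_square algebra_simps)
  then have E: "(x, y) \<in> root_pairs a" "(y, x) \<in> root_pairs a" using w by (auto simp: root_pairs_def algebra_simps)
  have ax: "a = - (x ^ 2 + y ^ 2 + x * y - x - y)" using E by (simp add: root_pairs_def)
  have f: "fst (root_pair_disc (x, y)) = b" "fst (root_pair_disc (y, x)) = b"
    unfolding b ax by (simp_all add: root_pair_disc_def Let_def power2_eq_square power3_eq_cube algebra_simps)
  have sw: "snd (root_pair_disc (y, x)) = - snd (root_pair_disc (x, y))"
    by (simp add: root_pair_disc_def Let_def algebra_simps)
  have "root_pair_disc (x, y) \<in> square_disc a" using root_pair_disc_in[OF E(1)] by auto
  then have "(b, snd (root_pair_disc (x, y))) \<in> square_disc a" using f(1) by (metis prod.collapse)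
  then have "(snd (root_pair_disc (x, y))) ^ 2 = k ^ 2" using bk by (simp add: square_disc_def)
  then have "snd (root_pair_disc (x, y)) = k \<or> snd (root_pair_disc (y, x)) = k"
    unfolding sw by (auto simp: power2_eq_iff)
  then show ?thesis using f E by (metis image_eqI prod.collapse)
qed

text \<open>The first component determines the root triple up to order, and the second one excludes odd permutations
unless two roots agree, in which case every odd permutation has the effect of a rotation.\<close>

lemma root_pair_disc_fibre:
  assumes s: "(x, y) \<in> root_pairs a"
  shows "{t \<in> root_pairs a. root_pair_disc t = root_pair_disc (x, y)} = {(x, y), (y, 1 - x - y), (1 - x - y, x)}"
proof (intro equalityI subsetI)
  fix t assume t: "t \<in> {(x, y), (y, 1 - x - y), (1 - x - y, x)}"
  then have "t \<in> root_pairs a" using s by (auto simp: root_pairs_def power2_eq_square algebra_simps)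
  moreover have "root_pair_disc t = root_pair_disc (x, y)"
    using t by (auto simp: root_pair_disc_def Let_def algebra_simps)
  ultimately show "t \<in> {t \<in> root_pairs a. root_pair_disc t = root_pair_disc (x, y)}" by blast
next
  fix t assume t: "t \<in> {t \<in> root_pairs a. root_pair_disc t = root_pair_disc (x, y)}"
  obtain u v where uv: "t = (u, v)" by (cases t)
  define z where "z = 1 - x - y"
  define w where "w = 1 - u - v"
  have ax: "x * y + y * z + z * x = u * v + v * w + w * u"
    using s t unfolding uv z_def w_def root_pairs_def by (simp add: power2_eq_square algebra_simps)
  have bk: "x * y * z = u * v * w" "(x - y) * (y - z) * (z - x) = (u - v) * (v - w) * (w - u)"
    using t unfolding uv by (auto simp: root_pair_disc_def Let_def z_def w_def)
  have sm: "x + y + z = u + v + w" by (simp add: z_def w_def)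
  \<comment> \<open>the case where the first roots agree; the other two cases are rotations of it\<close>
  have key: "(u, v) \<in> {(x, y), (y, z), (z, x)}"
    if h: "x * y + y * z + z * x = u * v + v * w + w * u" "x + y + z = u + v + w"
       "(x - y) * (y - z) * (z - x) = (u - v) * (v - w) * (w - u)" "u = x" for x y z u v w :: int
  proof -
    have w: "w = y + z - v" using h by simp
    have "(v - y) * (v - z) = 0" using h(1) unfolding w h(4) by (simp add: algebra_simps)
    then consider "v = y" | "v = z" by auto
    then show ?thesis
    proof cases
      case 2
      then have "(x - y) * (y - z) * (z - x) = - ((x - y) * (y - z) * (z - x))"
        using h(3) unfolding w h(4) by (simp add: algebra_simps)
      then have "(x - y) * (y - z) * (z - x) = 0" by linarith
      then show ?thesis using 2 h(4) by auto
    qed (use h in auto)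
  qed
  \<comment> \<open>\<open>u\<close> is a root of the polynomial with roots \<open>x, y, z\<close>\<close>
  have "(u - x) * (u - y) * (u - z) = u * u * (u + v + w) - u * u * (x + y + z) - u * (u * v + v * w + w * u) + u * (x * y + y * z + z * x) + u * v * w - x * y * z"
    by (simp add: algebra_simps)
  also have "\<dots> = 0" unfolding ax bk sm by simp
  finally consider "u = x" | "u = y" | "u = z" by auto
  then have "(u, v) \<in> {(x, y), (y, z), (z, x)}"
  proof cases
    case 1 show ?thesis using key[OF ax sm bk(2) 1] .
  next
    case 2
    have "(u, v) \<in> {(y, z), (z, x), (x, y)}"
      by (rule key[of y z x u v w]) (use ax sm bk 2 in \<open>simp_all add: algebra_simps\<close>)
    then show ?thesis by blast
  next
    case 3
    have "(u, v) \<in> {(z, x), (x, y), (y, z)}"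
      by (rule key[of z x y u v w]) (use ax sm bk 3 in \<open>simp_all add: algebra_simps\<close>)
    then show ?thesis by blast
  qed
  then show "t \<in> {(x, y), (y, 1 - x - y), (1 - x - y, x)}" by (simp add: uv z_def)
qed

lemma finite_square_disc: "finite (square_disc a)"
  using bij_betw_finite[OF bij_square_disc] finite_primary_of_norm by blast

lemma finite_root_pairs: "finite (root_pairs a)"
proof (rule finite_subset)
  show "root_pairs a \<subseteq> (\<Union>t\<in>square_disc a. {s \<in> root_pairs a. root_pair_disc s = t})"
    using root_pair_disc_in by fastforce
  have "finite {s \<in> root_pairs a. root_pair_disc s = t}" for t
  proof (cases "{s \<in> root_pairs a. root_pair_disc s = t} = {}")
    case False
    then obtain x y where "(x, y) \<in> root_pairs a" "root_pair_disc (x, y) = t" by auto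
    then show ?thesis using root_pair_disc_fibre[of x y a] by (metis finite.emptyI finite.insertI)
  next
    case True
    show ?thesis unfolding True by (rule finite.emptyI)
  qed
  then show "finite (\<Union>t\<in>square_disc a. {s \<in> root_pairs a. root_pair_disc s = t})"
    using finite_square_disc by blast
qed

lemma card_by_fibres:
  assumes "finite A" "\<And>x. x \<in> A \<Longrightarrow> card {y \<in> A. g y = g x} = c"
  shows "card A = c * card (g ` A)"
proof -
  have "card A = (\<Sum>y\<in>g ` A. card {x \<in> A. g x = y})"
    using sum.image_gen[OF assms(1), of "\<lambda>_. 1::nat" g] by simp
  also have "\<dots> = (\<Sum>y\<in>g ` A. c)" by (rule sum.cong) (use assms(2) in auto)
  finally show ?thesis by simp
qed

text \<open>The three rotations of a root triple are distinct: otherwise \<open>x = y = z\<close>, contrary to \<open>x + y + z = 1\<close>.\<close>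

lemma card_root_pairs:
  "card (root_pairs a) = 3 * card {(b, k) \<in> square_disc a. has_int_root a b}"
proof -
  have "card {t \<in> root_pairs a. root_pair_disc t = root_pair_disc s} = 3" if s: "s \<in> root_pairs a" for s
  proof -
    obtain x y where xy: "s = (x, y)" by (cases s)
    have d: "(x, y) \<noteq> (y, 1 - x - y)" "(x, y) \<noteq> (1 - x - y, x)" "(y, 1 - x - y) \<noteq> (1 - x - y, x)"
      by auto presburger+
    show ?thesis using s d unfolding xy by (simp only: root_pair_disc_fibre) simp
  qed
  then have "card (root_pairs a) = 3 * card (root_pair_disc ` root_pairs a)"
    using card_by_fibres[OF finite_root_pairs] by blast
  also have "root_pair_disc ` root_pairs a = {(b, k) \<in> square_disc a. has_int_root a b}"
    using root_pair_disc_in root_pair_disc_surj by (intro equalityI image_subsetI subsetI) auto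
  finally show ?thesis .
qed

text \<open>Without an integer root \<open>k \<noteq> 0\<close>, so \<open>k\<close> and \<open>- k\<close> are the two square roots of the discriminant.\<close>

lemma card_irreducible_square_disc:
  "card {(b, k) \<in> square_disc a. \<not> has_int_root a b} = 2 * card {b. \<not> has_int_root a b \<and> (\<exists>k. (b, k) \<in> square_disc a)}"
proof -
  let ?I = "{(b, k) \<in> square_disc a. \<not> has_int_root a b}"
  have fin: "finite ?I" by (rule finite_subset[OF _ finite_square_disc[of a]]) auto
  have "card {t \<in> ?I. fst t = fst s} = 2" if s: "s \<in> ?I" for s
  proof -
    obtain b k where bk: "s = (b, k)" by (cases s)
    have k0: "k \<noteq> 0" using s square_disc_0_has_int_root unfolding bk by auto
    have pm: "k' = k \<or> k' = - k" if "(b, k') \<in> square_disc a" for k'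
    proof -
      have "k' ^ 2 = k ^ 2" using s that unfolding bk square_disc_def by simp
      then show ?thesis by (simp add: power2_eq_iff)
    qed
    have "(b, - k) \<in> square_disc a" using s unfolding bk square_disc_def by simp
    then have "{t \<in> ?I. fst t = fst s} = {(b, k), (b, - k)}"
      using s unfolding bk by (auto dest: pm)
    then show ?thesis using k0 by simp
  qed
  then have "card ?I = 2 * card (fst ` ?I)" using card_by_fibres[OF fin] by blast
  also have "fst ` ?I = {b. \<not> has_int_root a b \<and> (\<exists>k. (b, k) \<in> square_disc a)}" by force
  finally show ?thesis .
qed

theorem count_irreducible_square_disc:
  assumes a: "a \<le> 0"
  shows "finite {b. \<not> has_int_root a b \<and> (\<exists>k. (b, k) \<in> square_disc a)}"
    and "real (card {b. \<not> has_int_root a b \<and> (\<exists>k. (b, k) \<in> square_disc a)}) =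
      1/2 * (\<Sum>d | d dvd nat (1 - 3 * a). divisor_weight d) - 1/6 * real (card (root_pairs a))"
proof -
  let ?B = "{b. \<not> has_int_root a b \<and> (\<exists>k. (b, k) \<in> square_disc a)}"
  let ?R = "{(b, k) \<in> square_disc a. has_int_root a b}" and ?I = "{(b, k) \<in> square_disc a. \<not> has_int_root a b}"
  have "?B \<subseteq> fst ` square_disc a" by force
  then show "finite ?B" using finite_square_disc finite_subset by blast
  have un: "?R \<union> ?I = square_disc a" and dis: "?R \<inter> ?I = {}" by auto
  have "finite ?R" "finite ?I" by (rule finite_subset[OF _ finite_square_disc[of a]]; auto)+
  then have "card (square_disc a) = card ?R + card ?I" using card_Un_disjoint[OF _ _ dis] unfolding un by blast
  moreover define n where "n = nat (1 - 3 * a)"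
  have n: "n > 0" "\<not> 3 dvd n" "int n = 1 - 3 * a" 
  proof -
    show n': "int n = 1 - 3 * a" using a unfolding n_def by simp
    then show "n > 0" using a by linarith
    have "\<not> 3 dvd int n" unfolding n' by presburger
    then show "\<not> 3 dvd n" by presburger
  qed
  have "card (square_disc a) = card (primary_of_norm (int (n ^ 3)))"
    using bij_betw_same_card[OF bij_square_disc[of a]] n(3) by simp
  ultimately have "real (card ?R) + real (card ?I) = (\<Sum>d | d dvd n. divisor_weight d)"
    using card_primary_of_norm_cube[OF n(1,2)] by simp
  then show "real (card ?B) = 1/2 * (\<Sum>d | d dvd nat (1 - 3 * a). divisor_weight d) - 1/6 * real (card (root_pairs a))"
    using card_root_pairs[of a] card_irreducible_square_disc[of a] unfolding n_def by simp
qed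

lemma card_E_integer_points:
  assumes a: "a \<le> 0"
  shows "finite (E (sqrt (1 - 3 * real_of_int a)) \<inter> \<int> \<times> \<int>)"
    and "card (E (sqrt (1 - 3 * real_of_int a)) \<inter> \<int> \<times> \<int>) = card (root_pairs a)"
proof -
  let ?r = "\<lambda>(x, y). (real_of_int x, real_of_int y)"
  have H: "(sqrt (1 - 3 * real_of_int a))\<^sup>2 = 1 - 3 * real_of_int a" using a by simp
  have iff: "(real_of_int x)\<^sup>2 + (real_of_int y)\<^sup>2 + real_of_int x * real_of_int y - real_of_int x - real_of_int y
      = - real_of_int a \<longleftrightarrow> x ^ 2 + y ^ 2 + x * y - x - y = - a" for x y
    by (metis (mono_tags, opaque_lifting) of_int_add of_int_diff of_int_eq_iff of_int_minus of_int_mult of_int_power)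
  have img: "E (sqrt (1 - 3 * real_of_int a)) \<inter> \<int> \<times> \<int> = ?r ` root_pairs a"
  proof (intro equalityI subsetI)
    fix s assume s: "s \<in> E (sqrt (1 - 3 * real_of_int a)) \<inter> \<int> \<times> \<int>"
    then obtain x y where xy: "s = (real_of_int x, real_of_int y)" by (auto elim!: Ints_cases)
    have "(x, y) \<in> root_pairs a" using s unfolding xy E_def H root_pairs_def by (simp add: iff)
    then show "s \<in> ?r ` root_pairs a" unfolding xy by force
  next
    fix s assume "s \<in> ?r ` root_pairs a"
    then obtain x y where xy: "s = (real_of_int x, real_of_int y)" "(x, y) \<in> root_pairs a" by auto
    then show "s \<in> E (sqrt (1 - 3 * real_of_int a)) \<inter> \<int> \<times> \<int>"
      unfolding xy E_def H root_pairs_def by (simp add: iff)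
  qed
  have "inj_on ?r (root_pairs a)" by (auto simp: inj_on_def)
  then show "finite (E (sqrt (1 - 3 * real_of_int a)) \<inter> \<int> \<times> \<int>)"
    "card (E (sqrt (1 - 3 * real_of_int a)) \<inter> \<int> \<times> \<int>) = card (root_pairs a)"
    unfolding img using finite_root_pairs by (simp_all add: card_image)
qed

section \<open>Automorphisms of a splitting field\<close>

text \<open>Subfields of the complex numbers contain the rationals; requiring this inclusion takes the place of the
axioms on \<open>0\<close> and \<open>1\<close>. Since \<open>inverse 0 = 0\<close>, closure under \<open>inverse\<close> needs no exception for \<open>0\<close>.\<close>

definition is_subfield :: "complex set \<Rightarrow> bool" where
  "is_subfield S \<longleftrightarrow> \<rat> \<subseteq> S \<and> (\<forall>x\<in>S. \<forall>y\<in>S. x + y \<in> S \<and> x * y \<in> S) \<and> (\<forall>x\<in>S. - x \<in> S \<and> inverse x \<in> S)"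

lemma complex_field_simps [simp]:
  "carrier complex_field = UNIV" "monoid.mult complex_field = (*)" "ring.add complex_field = (+)"
  "monoid.one complex_field = 1" "ring.zero complex_field = 0"
  by (simp_all add: ring_of_type_algebra_def fun_eq_iff)

lemma complex_field_inverses:
  shows "a_inv complex_field x = - x" and "x \<noteq> 0 \<Longrightarrow> m_inv complex_field x = inverse x"
proof -
  interpret K: Ring.field "complex_field" by (rule field_from_type_algebra)
  show "a_inv complex_field x = - x" using K.minus_equality[of "- x" x] by simp
  show "m_inv complex_field x = inverse x" if "x \<noteq> 0" using K.comm_inv_char[of x "inverse x"] that by simp
qed

lemma splitting_field_is_subfield: "is_subfield (splitting_field f)"
proof -
  let ?H = "\<rat> \<union> {z. poly (map_poly of_rat f) z = 0}"
  have q: "\<rat> \<subseteq> splitting_field f" unfolding splitting_field_def using generate_field.incl[of _ ?H complex_field] by blast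
  have "inverse x \<in> splitting_field f" if "x \<in> splitting_field f" for x
    using generate_field.m_inv[of x complex_field ?H] that complex_field_inverses(2)[of x] q
    unfolding splitting_field_def by (cases "x = 0") auto
  moreover have "- x \<in> splitting_field f" if "x \<in> splitting_field f" for x
    using generate_field.a_inv[of x complex_field ?H] that complex_field_inverses(1)[of x]
    unfolding splitting_field_def by simp
  moreover have "x + y \<in> splitting_field f" if "x \<in> splitting_field f" "y \<in> splitting_field f" for x y
    using generate_field.eng_add[of x complex_field ?H y] that unfolding splitting_field_def by simp
  moreover have "x * y \<in> splitting_field f" if "x \<in> splitting_field f" "y \<in> splitting_field f" for x y
    using generate_field.eng_mult[of x complex_field ?H y] that unfolding splitting_field_def by simp
  ultimately show ?thesis using q unfolding is_subfield_def by blast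
qed

lemma root_in_splitting_field: "poly (map_poly of_rat f) z = 0 \<Longrightarrow> z \<in> splitting_field f"
  unfolding splitting_field_def by (rule generate_field.incl) simp

lemma splitting_field_least:
  assumes S: "is_subfield S" and "\<And>z. poly (map_poly of_rat f) z = 0 \<Longrightarrow> z \<in> S"
  shows "splitting_field f \<subseteq> S"
proof
  fix x assume "x \<in> splitting_field f"
  then show "x \<in> S" unfolding splitting_field_def
  proof (induction rule: generate_field.induct)
    case one
    have "(1::complex) \<in> \<rat>" by simp
    then show ?case using S unfolding is_subfield_def by auto
  next
    case (incl h) then show ?case using S assms(2) unfolding is_subfield_def by blast
  next
    case (a_inv h) then show ?case using S unfolding is_subfield_def by (simp add: complex_field_inverses)
  next
    case (m_inv h) then show ?case using S unfolding is_subfield_def by (simp add: complex_field_inverses)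
  next
    case (eng_add x y) then show ?case using S unfolding is_subfield_def by simp
  next
    case (eng_mult x y) then show ?case using S unfolding is_subfield_def by simp
  qed
qed

text \<open>The carrier of the Galois group in elementary terms; see \<open>carrier_galois_group\<close>.\<close>

definition field_auts :: "complex set \<Rightarrow> (complex \<Rightarrow> complex) set" where
  "field_auts L = {\<tau> \<in> extensional L. bij_betw \<tau> L L \<and> (\<forall>q\<in>\<rat>. \<tau> q = q) \<and>
     (\<forall>x\<in>L. \<forall>y\<in>L. \<tau> (x + y) = \<tau> x + \<tau> y \<and> \<tau> (x * y) = \<tau> x * \<tau> y)}"

lemma carrier_galois_group: "carrier (galois_group f) = field_auts (splitting_field f)"
proof -
  let ?L = "splitting_field f"
  have Q: "\<rat> \<subseteq> ?L" using splitting_field_is_subfield unfolding is_subfield_def by blast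
  have "carrier (galois_group f) = {\<sigma> \<in> ring_iso (complex_field\<lparr>carrier := ?L\<rparr>) (complex_field\<lparr>carrier := ?L\<rparr>) \<inter> extensional ?L. \<forall>q\<in>\<rat>. \<sigma> q = q}"
    by (simp add: galois_group_def Let_def)
  also have "\<dots> = field_auts ?L"
    unfolding field_auts_def ring_iso_def ring_hom_def by (auto simp: bij_betw_def)
  finally show ?thesis .
qed

lemma mult_galois_group:
  assumes "\<sigma> \<in> field_auts (splitting_field f)" "\<tau> \<in> field_auts (splitting_field f)"
  shows "monoid.mult (galois_group f) \<sigma> \<tau> = compose (splitting_field f) \<sigma> \<tau>"
  using assms by (simp add: galois_group_def Let_def BijGroup_def field_auts_def Bij_def)

context
  fixes L :: "complex set" and \<tau> assumes L: "is_subfield L" and \<tau>: "\<tau> \<in> field_auts L"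
begin

lemma field_aut_closed: "x \<in> L \<Longrightarrow> \<tau> x \<in> L"
  using \<tau> unfolding field_auts_def bij_betw_def by blast

lemma field_aut_inj: "x \<in> L \<Longrightarrow> y \<in> L \<Longrightarrow> \<tau> x = \<tau> y \<longleftrightarrow> x = y"
  using \<tau> unfolding field_auts_def bij_betw_def inj_on_def by blast

lemma field_aut_rat: "q \<in> \<rat> \<Longrightarrow> \<tau> q = q"
  using \<tau> unfolding field_auts_def by blast

lemma field_aut_add: "x \<in> L \<Longrightarrow> y \<in> L \<Longrightarrow> \<tau> (x + y) = \<tau> x + \<tau> y"
  and field_aut_mult: "x \<in> L \<Longrightarrow> y \<in> L \<Longrightarrow> \<tau> (x * y) = \<tau> x * \<tau> y"
  using \<tau> unfolding field_auts_def by blast+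

lemma field_aut_minus: "x \<in> L \<Longrightarrow> \<tau> (- x) = - \<tau> x"
  using field_aut_mult[of "-1" x] field_aut_rat[of "-1"] L unfolding is_subfield_def by (auto simp: subset_iff)

lemma field_aut_diff: "x \<in> L \<Longrightarrow> y \<in> L \<Longrightarrow> \<tau> (x - y) = \<tau> x - \<tau> y"
  using field_aut_add[of x "- y"] field_aut_minus[of y] L unfolding is_subfield_def by simp

lemma field_aut_inverse: "x \<in> L \<Longrightarrow> \<tau> (inverse x) = inverse (\<tau> x)"
proof (cases "x = 0")
  case False
  assume x: "x \<in> L"
  then have "\<tau> x * \<tau> (inverse x) = 1"
    using field_aut_mult[of x "inverse x"] field_aut_rat[of 1] L False unfolding is_subfield_def by simp
  then show ?thesis by (metis inverse_unique)
qed (simp add: field_aut_rat)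

lemma fixed_points_subfield: "is_subfield {x \<in> L. \<tau> x = x}"
  using L unfolding is_subfield_def
  by (auto simp: field_aut_rat field_aut_add field_aut_mult field_aut_minus field_aut_inverse)

end

lemma field_aut_eqI:
  assumes "\<sigma> \<in> field_auts L" "\<tau> \<in> field_auts L" "\<And>x. x \<in> L \<Longrightarrow> \<sigma> x = \<tau> x"
  shows "\<sigma> = \<tau>"
  using assms unfolding field_auts_def by (auto intro: extensionalityI)

lemma field_aut_id: "(\<lambda>x\<in>L. x) \<in> field_auts L" if "is_subfield L"
  using that unfolding field_auts_def is_subfield_def by (auto simp: bij_betw_def inj_on_def subset_iff)

lemma field_aut_compose:
  assumes L: "is_subfield L" and st: "\<sigma> \<in> field_auts L" "\<tau> \<in> field_auts L"
  shows "compose L \<sigma> \<tau> \<in> field_auts L"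
proof -
  have "bij_betw (compose L \<sigma> \<tau>) L L"
    using st by (auto simp: field_auts_def intro: bij_betw_compose)
  moreover have "compose L \<sigma> \<tau> q = q" if "q \<in> \<rat>" for q
  proof -
    have "q \<in> L" using that L unfolding is_subfield_def by blast
    then show ?thesis by (simp add: compose_eq field_aut_rat[OF L st(1) that] field_aut_rat[OF L st(2) that])
  qed
  moreover have "compose L \<sigma> \<tau> (x + y) = compose L \<sigma> \<tau> x + compose L \<sigma> \<tau> y \<and> compose L \<sigma> \<tau> (x * y) = compose L \<sigma> \<tau> x * compose L \<sigma> \<tau> y"
    if xy: "x \<in> L" "y \<in> L" for x y
  proof -
    have "x + y \<in> L" "x * y \<in> L" "\<tau> x \<in> L" "\<tau> y \<in> L"
      using xy L field_aut_closed[OF L st(2)] unfolding is_subfield_def by blast+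
    then show ?thesis using xy
      by (simp add: compose_eq field_aut_add[OF L st(1)] field_aut_add[OF L st(2)]
          field_aut_mult[OF L st(1)] field_aut_mult[OF L st(2)])
  qed
  ultimately show ?thesis unfolding field_auts_def by simp
qed

text \<open>The fixed points form a subfield; if it contains the roots, it is the whole splitting field.\<close>

lemma field_aut_determined_on_roots:
  assumes \<tau>: "\<tau> \<in> field_auts (splitting_field f)" and fixed: "\<And>z. poly (map_poly of_rat f) z = 0 \<Longrightarrow> \<tau> z = z"
  shows "\<tau> = (\<lambda>x\<in>splitting_field f. x)"
proof (rule field_aut_eqI[OF \<tau> field_aut_id[OF splitting_field_is_subfield]])
  have "splitting_field f \<subseteq> {x \<in> splitting_field f. \<tau> x = x}"
    by (rule splitting_field_least[OF fixed_points_subfield[OF splitting_field_is_subfield \<tau>]])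
      (simp add: fixed root_in_splitting_field)
  then show "\<tau> x = (\<lambda>x\<in>splitting_field f. x) x" if "x \<in> splitting_field f" for x using that by auto
qed

text \<open>How automorphisms are constructed: if \<open>\<phi>\<close> and \<open>\<psi>\<close> are two parametrisations of \<open>L\<close> that identify the
same parameters and are compatible with the same operations on parameters, then \<open>\<phi> i \<mapsto> \<psi> i\<close> is well defined and an
automorphism. The parameters are rational polynomials in the first application below, and pairs of them in the
second one.\<close>

lemma field_aut_from_parametrisation:
  fixes \<phi> \<psi> :: "'i \<Rightarrow> complex"
  assumes ran: "range \<phi> = L" "range \<psi> = L" and inj: "\<And>i j. \<phi> i = \<phi> j \<longleftrightarrow> \<psi> i = \<psi> j"
    and add: "\<And>i j. \<exists>k. \<phi> k = \<phi> i + \<phi> j \<and> \<psi> k = \<psi> i + \<psi> j"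
    and mult: "\<And>i j. \<exists>k. \<phi> k = \<phi> i * \<phi> j \<and> \<psi> k = \<psi> i * \<psi> j"
    and rat: "\<And>q. q \<in> \<rat> \<Longrightarrow> \<exists>k. \<phi> k = q \<and> \<psi> k = q"
  obtains \<tau> where "\<tau> \<in> field_auts L" "\<And>i. \<tau> (\<phi> i) = \<psi> i"
proof -
  define \<tau> where "\<tau> = (\<lambda>z\<in>L. \<psi> (SOME i. \<phi> i = z))"
  have \<tau>: "\<tau> (\<phi> i) = \<psi> i" for i
  proof -
    have "\<phi> (SOME j. \<phi> j = \<phi> i) = \<phi> i" by (rule someI) simp
    then have "\<psi> (SOME j. \<phi> j = \<phi> i) = \<psi> i" using inj by blast
    then show ?thesis using ran(1) by (auto simp: \<tau>_def)
  qed
  have "\<tau> ` L = L" using ran \<tau> by (metis (no_types, lifting) image_cong image_image)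
  moreover have "inj_on \<tau> L" using ran(1) inj \<tau> by (auto simp: inj_on_def)
  ultimately have "bij_betw \<tau> L L" by (simp add: bij_betw_def)
  moreover have "\<tau> q = q" if "q \<in> \<rat>" for q using rat[OF that] \<tau> by metis
  moreover have "\<tau> (x + y) = \<tau> x + \<tau> y" "\<tau> (x * y) = \<tau> x * \<tau> y" if "x \<in> L" "y \<in> L" for x y
  proof -
    have "x \<in> range \<phi>" "y \<in> range \<phi>" using that ran(1) by simp_all
    then obtain i j where ij: "x = \<phi> i" "y = \<phi> j" by blast
    show "\<tau> (x + y) = \<tau> x + \<tau> y" using add[of i j] unfolding ij by (metis \<tau>)
    show "\<tau> (x * y) = \<tau> x * \<tau> y" using mult[of i j] unfolding ij by (metis \<tau>)
  qed
  ultimately have "\<tau> \<in> field_auts L" unfolding field_auts_def by (simp add: \<tau>_def)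
  then show thesis using that \<tau> by blast
qed

section \<open>Cubics whose roots have sum one\<close>

definition rat_eval :: "rat poly \<Rightarrow> complex \<Rightarrow> complex" where
  "rat_eval p x = poly (map_poly of_rat p) x"

lemma rat_eval_0 [simp]: "rat_eval 0 x = 0"
  by (simp add: rat_eval_def)

lemma rat_eval_pCons [simp]: "rat_eval (pCons c p) x = of_rat c + x * rat_eval p x"
  by (simp add: rat_eval_def map_poly_pCons)

lemma rat_eval_1 [simp]: "rat_eval 1 x = 1"
  by (simp add: one_pCons)

lemma rat_eval_add [simp]: "rat_eval (p + q) x = rat_eval p x + rat_eval q x"
  by (induction p q rule: poly_induct2) (simp_all add: of_rat_add algebra_simps)

lemma rat_eval_smult [simp]: "rat_eval (Polynomial.smult c p) x = of_rat c * rat_eval p x"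
  by (induction p) (simp_all add: of_rat_mult algebra_simps)

lemma rat_eval_mult [simp]: "rat_eval (p * q) x = rat_eval p x * rat_eval q x"
  by (induction p) (simp_all add: algebra_simps)

lemma rat_eval_minus [simp]: "rat_eval (- p) x = - rat_eval p x"
  by (induction p) (simp_all add: of_rat_minus)

lemma rat_eval_diff [simp]: "rat_eval (p - q) x = rat_eval p x - rat_eval q x"
  using rat_eval_add[of p "- q" x] by simp

lemma rat_eval_rat: "rat_eval p (of_rat r) = of_rat (poly p r)"
  by (induction p) (simp_all add: of_rat_add of_rat_mult)

lemma rat_eval_in_subfield: "is_subfield S \<Longrightarrow> x \<in> S \<Longrightarrow> rat_eval p x \<in> S"
  by (induction p) (auto simp: is_subfield_def subset_iff)

lemma field_aut_rat_eval:
  assumes "is_subfield L" "\<tau> \<in> field_auts L" "x \<in> L"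
  shows "\<tau> (rat_eval p x) = rat_eval p (\<tau> x)"
proof (induction p)
  case (pCons c p)
  have e: "rat_eval p x \<in> L" using rat_eval_in_subfield assms by blast
  have "(of_rat c :: complex) \<in> \<rat>" by simp
  moreover from this have "of_rat c \<in> L" "x * rat_eval p x \<in> L" using e assms unfolding is_subfield_def by blast+
  ultimately show ?case
    using e pCons.IH by (simp add: field_aut_add[OF assms(1,2)] field_aut_mult[OF assms(1,2)] field_aut_rat[OF assms(1,2)] assms(3))
qed (simp add: field_aut_rat[OF assms(1,2)])

locale cubic_roots =
  fixes a b :: int and x y z :: complex
  assumes e1: "x + y + z = 1" and e2: "x * y + y * z + z * x = of_int a" and e3: "x * y * z = - of_int b"
begin

definition f :: "rat poly" where "f = map_poly of_int [:b, a, -1, 1:]"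
definition L :: "complex set" where "L = splitting_field f"
definition \<delta> :: complex where "\<delta> = (x - y) * (y - z) * (z - x)"

lemma f_eq: "f = [:of_int b, of_int a, -1, 1:]"
  by (simp add: f_def map_poly_pCons)

lemma f_eval: "rat_eval f t = (t - x) * (t - y) * (t - z)"
proof -
  have "(t - x) * (t - y) * (t - z) = t ^ 3 - (x + y + z) * t ^ 2 + (x * y + y * z + z * x) * t - x * y * z"
    by (simp add: algebra_simps power2_eq_square power3_eq_cube)
  also have "\<dots> = rat_eval f t"
    unfolding e1 e2 e3 by (simp add: f_eq algebra_simps power2_eq_square power3_eq_cube)
  finally show ?thesis ..
qed

lemma f_roots: "poly (map_poly of_rat f) t = 0 \<longleftrightarrow> t \<in> {x, y, z}"
  using f_eval[of t] by (auto simp: rat_eval_def)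

lemma roots_L: "x \<in> L" "y \<in> L" "z \<in> L"
  using root_in_splitting_field f_roots unfolding L_def by blast+

lemma L_subfield: "is_subfield L"
  unfolding L_def by (rule splitting_field_is_subfield)

lemma L_least: "is_subfield S \<Longrightarrow> x \<in> S \<Longrightarrow> y \<in> S \<Longrightarrow> z \<in> S \<Longrightarrow> L \<subseteq> S"
  unfolding L_def by (rule splitting_field_least) (auto simp: f_roots)

lemma L_closed:
  "q \<in> \<rat> \<Longrightarrow> q \<in> L" "u \<in> L \<Longrightarrow> v \<in> L \<Longrightarrow> u + v \<in> L" "u \<in> L \<Longrightarrow> v \<in> L \<Longrightarrow> u * v \<in> L"
  "u \<in> L \<Longrightarrow> - u \<in> L" "u \<in> L \<Longrightarrow> inverse u \<in> L" "u \<in> L \<Longrightarrow> v \<in> L \<Longrightarrow> u - v \<in> L"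
  using L_subfield unfolding is_subfield_def by (auto simp: diff_conv_add_uminus simp del: add_uminus_conv_diff)

lemma rotate: "cubic_roots a b y z x"
  using e1 e2 e3 by unfold_locales (simp_all add: algebra_simps)

lemma swap: "cubic_roots a b x z y"
  using e1 e2 e3 by unfold_locales (simp_all add: algebra_simps)

lemma disc: "\<delta> ^ 2 = of_int (a ^ 2 - 4 * a ^ 3 + 4 * b - 27 * b ^ 2 - 18 * a * b)"
proof -
  have z: "z = 1 - x - y" using e1 by (simp add: algebra_simps)
  have b: "of_int b = - (x * y * z)" using e3 by simp
  show ?thesis unfolding \<delta>_def of_int_diff of_int_add of_int_mult of_int_power of_int_numeral e2[symmetric] b
    unfolding z by (simp add: power2_eq_square power3_eq_cube algebra_simps)
qed

lemma aut_root: "\<tau> \<in> field_auts L \<Longrightarrow> u \<in> {x, y, z} \<Longrightarrow> \<tau> u \<in> {x, y, z}"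
proof -
  assume \<tau>: "\<tau> \<in> field_auts L" and u: "u \<in> {x, y, z}"
  have "rat_eval f u = 0" using u f_eval by auto
  then have "rat_eval f (\<tau> u) = 0"
    using field_aut_rat_eval[OF L_subfield \<tau>, of u f] field_aut_rat[OF L_subfield \<tau>, of 0] u roots_L by auto
  then show ?thesis using f_eval by auto
qed

lemma aut_\<delta>:
  assumes "\<tau> \<in> field_auts L"
  shows "\<tau> \<delta> = (\<tau> x - \<tau> y) * (\<tau> y - \<tau> z) * (\<tau> z - \<tau> x)"
  unfolding \<delta>_def
  by (simp add: field_aut_mult[OF L_subfield assms] field_aut_diff[OF L_subfield assms] L_closed roots_L)

end

locale irreducible_cubic_roots = cubic_roots +
  assumes irrational: "x \<notin> \<rat>" "y \<notin> \<rat>" "z \<notin> \<rat>"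
begin

lemma rotate': "irreducible_cubic_roots a b y z x"
  using rotate irrational by (simp add: irreducible_cubic_roots_def irreducible_cubic_roots_axioms_def)

lemma f_nz: "f \<noteq> 0" and f_degree: "Polynomial.degree f = 3"
  by (simp_all add: f_eq)

lemma f_no_rat_root: "poly f r \<noteq> 0"
proof
  assume "poly f r = 0"
  then have "of_rat r \<in> {x, y, z}" using f_eval[of "of_rat r"] by (auto simp: rat_eval_rat)
  moreover have "of_rat r \<in> (\<rat> :: complex set)" by simp
  ultimately show False using irrational by auto
qed

lemma f_irreducible: "Factorial_Ring.irreducible f"
proof (rule irreducibleI)
  show "f \<noteq> 0" by (rule f_nz)
  show "\<not> is_unit f" using is_unit_iff_degree[OF f_nz] f_degree by simp
  fix p q assume pq: "f = p * q"
  then have nz: "p \<noteq> 0" "q \<noteq> 0" using f_nz by auto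
  have no_linear: "Polynomial.degree g \<noteq> 1" if gf: "g dvd f" for g
  proof
    assume deg: "Polynomial.degree g = 1"
    obtain c h where gh: "g = pCons c h" by (cases g)
    have h: "h \<noteq> 0" "Polynomial.degree h = 0" using deg gh by (auto split: if_splits)
    then obtain d where hd: "h = [:d:]" by (elim degree_eq_zeroE)
    have "poly g (- c / d) = 0" using h(1) by (simp add: gh hd)
    moreover obtain k where "f = g * k" using gf by blast
    ultimately have "poly f (- c / d) = 0" by simp
    then show False using f_no_rat_root by blast
  qed
  have "Polynomial.degree p + Polynomial.degree q = 3" using pq f_degree degree_mult_eq[OF nz] by simp
  moreover have "Polynomial.degree p \<noteq> 1" "Polynomial.degree q \<noteq> 1" using no_linear pq by auto
  ultimately have "Polynomial.degree p = 0 \<or> Polynomial.degree q = 0" by linarith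
  then show "is_unit p \<or> is_unit q" using is_unit_iff_degree[OF nz(1)] is_unit_iff_degree[OF nz(2)] by blast
qed

text \<open>Since \<open>f\<close> is irreducible, a polynomial \<open>p\<close> that it does not divide is invertible modulo \<open>f\<close>; one Bezout
coefficient serves for all three roots.\<close>

lemma eval_inverse:
  assumes "\<not> f dvd p"
  obtains r where "\<And>u. u \<in> {x, y, z} \<Longrightarrow> rat_eval p u * rat_eval r u = 1"
proof -
  have "prime_elem f" using f_irreducible by (rule irreducible_imp_prime_elem_gcd)
  then have "Rings.coprime f p" using assms by (rule prime_elem_imp_coprime)
  then have "gcd f p = 1" by simp
  then have "fst (bezout_coefficients f p) * f + snd (bezout_coefficients f p) * p = 1"
    using bezout_coefficients_fst_snd[of f p] by simp
  then obtain s r where sr: "s * f + r * p = 1" by blast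
  have "rat_eval p u * rat_eval r u = 1" if "u \<in> {x, y, z}" for u
  proof -
    have "rat_eval f u = 0" using that unfolding f_eval by auto
    then show ?thesis using arg_cong[OF sr, of "\<lambda>q. rat_eval q u"] by (simp add: mult.commute)
  qed
  then show thesis using that by blast
qed

lemma eval_eq_0_iff: "u \<in> {x, y, z} \<Longrightarrow> rat_eval p u = 0 \<longleftrightarrow> f dvd p"
proof
  assume u: "u \<in> {x, y, z}"
  show "f dvd p" if "rat_eval p u = 0"
  proof (rule ccontr)
    assume "\<not> f dvd p"
    then obtain r where "rat_eval p u * rat_eval r u = 1" using eval_inverse u by blast
    then show False using that by simp
  qed
  show "rat_eval p u = 0" if "f dvd p"
  proof -
    have "rat_eval f u = 0" using u unfolding f_eval by auto
    moreover obtain k where "p = f * k" using \<open>f dvd p\<close> by blast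
    ultimately show ?thesis by simp
  qed
qed

text \<open>A double root would be a root of the derivative, whose degree is less than that of the irreducible
polynomial \<open>f\<close>.\<close>

lemma roots_distinct: "x \<noteq> y" "y \<noteq> z" "z \<noteq> x"
proof -
  define f' where "f' = [:of_int a, -2, 3 :: rat:]"
  have nd: "\<not> f dvd f'"
  proof
    assume "f dvd f'"
    moreover have "f' \<noteq> 0" by (simp add: f'_def)
    ultimately have "Polynomial.degree f \<le> Polynomial.degree f'" by (rule dvd_imp_degree_le)
    then show False by (simp add: f_degree f'_def)
  qed
  have e: "rat_eval f' t = (t - x) * (t - y) + (t - y) * (t - z) + (t - z) * (t - x)" for t
  proof -
    have "(t - x) * (t - y) + (t - y) * (t - z) + (t - z) * (t - x) = 3 * t ^ 2 - 2 * (x + y + z) * t + (x * y + y * z + z * x)"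
      by (simp add: algebra_simps power2_eq_square)
    also have "\<dots> = rat_eval f' t" unfolding e1 e2 by (simp add: f'_def algebra_simps power2_eq_square of_rat_minus)
    finally show ?thesis ..
  qed
  have "rat_eval f' x \<noteq> 0" "rat_eval f' y \<noteq> 0"
    using nd eval_eq_0_iff[of x f'] eval_eq_0_iff[of y f'] by simp_all
  then have "(x - y) * (x - z) \<noteq> 0" "(y - z) * (y - x) \<noteq> 0" by (simp_all add: e)
  then show "x \<noteq> y" "y \<noteq> z" "z \<noteq> x" by auto
qed

lemma \<delta>_nz: "\<delta> \<noteq> 0"
  using roots_distinct by (simp add: \<delta>_def)

text \<open>The sum of \<open>y\<close> and \<open>z\<close> is \<open>1 - x\<close>, and their difference is \<open>\<delta>\<close> up to sign and division by the derivative at \<open>x\<close>, which is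
\<open>(x - y) (x - z)\<close>. Hence both lie in \<open>\<rat>(x, \<delta>)\<close>.\<close>

lemma other_roots:
  obtains r where "y = rat_eval [:1/2, -1/2:] x - rat_eval r x * \<delta>" "z = rat_eval [:1/2, -1/2:] x + rat_eval r x * \<delta>"
proof -
  define f' where "f' = [:of_int a, -2, 3 :: rat:]"
  have "(x - y) * (x - z) = 3 * x ^ 2 - 2 * (x + y + z) * x + (x * y + y * z + z * x)"
    by (simp add: algebra_simps power2_eq_square)
  also have "\<dots> = rat_eval f' x" unfolding e1 e2 by (simp add: f'_def algebra_simps power2_eq_square of_rat_minus)
  finally have e: "rat_eval f' x = (x - y) * (x - z)" ..
  then have "rat_eval f' x \<noteq> 0" using roots_distinct by auto
  then have "\<not> f dvd f'" using eval_eq_0_iff[of x] by simp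
  then obtain r where r: "rat_eval f' x * rat_eval r x = 1" using eval_inverse by blast
  have "\<delta> = - rat_eval f' x * (y - z)" unfolding e \<delta>_def by (simp add: algebra_simps)
  then have "rat_eval r x * \<delta> = - (rat_eval f' x * rat_eval r x) * (y - z)" by simp
  then have rd: "rat_eval r x * \<delta> = z - y" unfolding r by simp
  have yz: "y + z = 1 - x" using e1 by (simp add: algebra_simps)
  show thesis
  proof (rule that[of "Polynomial.smult (1/2) r"])
    have "rat_eval [:1/2, -1/2:] x = (y + z) / 2" unfolding yz by (simp add: of_rat_divide of_rat_minus field_simps)
    moreover have "rat_eval (Polynomial.smult (1/2) r) x * \<delta> = (z - y) / 2"
      by (simp add: rd of_rat_divide mult.assoc)
    ultimately show "y = rat_eval [:1/2, -1/2:] x - rat_eval (Polynomial.smult (1/2) r) x * \<delta>"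
      "z = rat_eval [:1/2, -1/2:] x + rat_eval (Polynomial.smult (1/2) r) x * \<delta>"
      by (simp_all only:) (simp_all add: field_simps)
  qed
qed

lemma simple_extension_subfield: "is_subfield (range (\<lambda>p. rat_eval p x))"
  unfolding is_subfield_def
proof (intro conjI subsetI ballI)
  fix q :: complex assume "q \<in> \<rat>"
  then obtain c where "q = of_rat c" by (auto elim: Rats_cases)
  then show "q \<in> range (\<lambda>p. rat_eval p x)" by (intro range_eqI[of _ _ "[:c:]"]) simp
next
  fix u v assume "u \<in> range (\<lambda>p. rat_eval p x)" "v \<in> range (\<lambda>p. rat_eval p x)"
  then obtain p q where pq: "u = rat_eval p x" "v = rat_eval q x" by blast
  show "u + v \<in> range (\<lambda>p. rat_eval p x)" "u * v \<in> range (\<lambda>p. rat_eval p x)"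
    unfolding pq rat_eval_add[symmetric] rat_eval_mult[symmetric] by blast+
next
  fix u assume "u \<in> range (\<lambda>p. rat_eval p x)"
  then obtain p where p: "u = rat_eval p x" by blast
  show "- u \<in> range (\<lambda>p. rat_eval p x)" unfolding p rat_eval_minus[symmetric] by blast
  show "inverse u \<in> range (\<lambda>p. rat_eval p x)"
  proof (cases "u = 0")
    case True
    then show ?thesis by (intro range_eqI[of _ _ 0]) simp
  next
    case False
    then obtain r where "rat_eval p x * rat_eval r x = 1" using eval_inverse eval_eq_0_iff[of x p] p by blast
    then have "inverse u = rat_eval r x" unfolding p by (rule inverse_unique)
    then show ?thesis by blast
  qed
qed

lemma splitting_field_simple:
  assumes "\<delta> \<in> \<rat>"
  shows "L = range (\<lambda>p. rat_eval p x)"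
proof
  obtain c where c: "\<delta> = of_rat c" using assms by (auto elim: Rats_cases)
  obtain r where r: "y = rat_eval [:1/2, -1/2:] x - rat_eval r x * \<delta>" "z = rat_eval [:1/2, -1/2:] x + rat_eval r x * \<delta>"
    using other_roots .
  have "y = rat_eval ([:1/2, -1/2:] - Polynomial.smult c r) x"
    by (subst r(1)) (simp add: c mult.commute)
  moreover have "z = rat_eval ([:1/2, -1/2:] + Polynomial.smult c r) x"
    by (subst r(2)) (simp add: c mult.commute)
  moreover have "x = rat_eval [:0, 1:] x" by simp
  ultimately show "L \<subseteq> range (\<lambda>p. rat_eval p x)"
    by (intro L_least simple_extension_subfield) blast+
  show "range (\<lambda>p. rat_eval p x) \<subseteq> L"
    using rat_eval_in_subfield[OF L_subfield roots_L(1)] by blast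
qed

end

section \<open>The cyclic cubic Galois group\<close>

context irreducible_cubic_roots
begin

lemma aut_permutes:
  assumes \<tau>: "\<tau> \<in> field_auts L"
  shows "\<tau> x \<noteq> \<tau> y" "\<tau> y \<noteq> \<tau> z" "\<tau> z \<noteq> \<tau> x"
  using field_aut_inj[OF L_subfield \<tau>] roots_L roots_distinct by auto

text \<open>Automorphisms fix the rational number \<open>\<delta> \<noteq> 0\<close>, so they induce even permutations of the roots.\<close>

lemma rational_\<delta>_aut_cyclic:
  assumes \<delta>: "\<delta> \<in> \<rat>" and \<tau>: "\<tau> \<in> field_auts L"
  shows "(\<tau> x, \<tau> y, \<tau> z) \<in> {(x, y, z), (y, z, x), (z, x, y)}"
proof -
  have d: "(\<tau> x - \<tau> y) * (\<tau> y - \<tau> z) * (\<tau> z - \<tau> x) = \<delta>"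
    using aut_\<delta>[OF \<tau>] field_aut_rat[OF L_subfield \<tau> \<delta>] by simp
  \<comment> \<open>an odd permutation of the roots would negate \<open>\<delta>\<close>\<close>
  have odd: "(u - v) * (v - w) * (w - u) \<noteq> \<delta>" if "(u, v, w) \<in> {(x, z, y), (z, y, x), (y, x, z)}" for u v w
  proof
    assume "(u - v) * (v - w) * (w - u) = \<delta>"
    moreover have "(u - v) * (v - w) * (w - u) = - \<delta>" using that by (auto simp: \<delta>_def algebra_simps)
    ultimately show False using \<delta>_nz by simp
  qed
  have "\<tau> x \<in> {x, y, z}" "\<tau> y \<in> {x, y, z}" "\<tau> z \<in> {x, y, z}" using aut_root[OF \<tau>] by blast+
  then have "(\<tau> x, \<tau> y, \<tau> z) \<in> {(x, y, z), (y, z, x), (z, x, y)} \<union> {(x, z, y), (z, y, x), (y, x, z)}"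
    using aut_permutes[OF \<tau>] by auto
  then show ?thesis using odd d by blast
qed

text \<open>For rational \<open>\<delta>\<close> any root generates the splitting field, and \<open>p(x) \<mapsto> p(u)\<close> is an automorphism because \<open>x\<close>
and \<open>u\<close> have the same minimal polynomial \<open>f\<close>.\<close>

lemma rational_\<delta>_aut_exists:
  assumes \<delta>: "\<delta> \<in> \<rat>" and u: "u \<in> {x, y, z}"
  obtains \<tau> where "\<tau> \<in> field_auts L" "\<tau> x = u"
proof -
  have Lu: "L = range (\<lambda>p. rat_eval p u)"
  proof -
    interpret yzx: irreducible_cubic_roots a b y z x by (rule rotate')
    interpret zxy: irreducible_cubic_roots a b z x y by (rule yzx.rotate')
    have "yzx.\<delta> = \<delta>" "zxy.\<delta> = \<delta>" unfolding \<delta>_def yzx.\<delta>_def zxy.\<delta>_def by simp_all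
    then show ?thesis using u splitting_field_simple yzx.splitting_field_simple zxy.splitting_field_simple \<delta> by auto
  qed
  obtain \<tau> where \<tau>: "\<tau> \<in> field_auts L" "\<And>p. \<tau> (rat_eval p x) = rat_eval p u"
  proof (rule field_aut_from_parametrisation[of "\<lambda>p. rat_eval p x" L "\<lambda>p. rat_eval p u"])
    show "range (\<lambda>p. rat_eval p x) = L" using splitting_field_simple[OF \<delta>] by simp
    show "range (\<lambda>p. rat_eval p u) = L" using Lu by simp
    show "rat_eval p x = rat_eval q x \<longleftrightarrow> rat_eval p u = rat_eval q u" for p q
      using eval_eq_0_iff[of x "p - q"] eval_eq_0_iff[OF u, of "p - q"] by simp
    show "\<exists>k. rat_eval k x = rat_eval p x + rat_eval q x \<and> rat_eval k u = rat_eval p u + rat_eval q u" for p q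
      by (rule exI[of _ "p + q"]) simp
    show "\<exists>k. rat_eval k x = rat_eval p x * rat_eval q x \<and> rat_eval k u = rat_eval p u * rat_eval q u" for p q
      by (rule exI[of _ "p * q"]) simp
    show "\<exists>k. rat_eval k x = q \<and> rat_eval k u = q" if q: "q \<in> \<rat>" for q
    proof -
      obtain c where "q = of_rat c" using q by (auto elim: Rats_cases)
      then show ?thesis by (intro exI[of _ "[:c:]"]) simp
    qed
  qed blast
  have "\<tau> x = u" using \<tau>(2)[of "[:0, 1:]"] by simp
  then show thesis using that \<tau>(1) by blast
qed

lemma rational_\<delta>_aut_eqI:
  assumes \<delta>: "\<delta> \<in> \<rat>" and st: "\<sigma> \<in> field_auts L" "\<tau> \<in> field_auts L" "\<sigma> x = \<tau> x"
  shows "\<sigma> = \<tau>"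
proof (rule field_aut_eqI[OF st(1,2)])
  fix w assume "w \<in> L"
  then obtain p where "w = rat_eval p x" using splitting_field_simple[OF \<delta>] by blast
  then show "\<sigma> w = \<tau> w"
    using field_aut_rat_eval[OF L_subfield st(1) roots_L(1)] field_aut_rat_eval[OF L_subfield st(2) roots_L(1)] st(3) by simp
qed

text \<open>The isomorphism records by how many steps the cycle \<open>x, y, z\<close> is rotated.\<close>

theorem galois_group_cyclic_if_rational_\<delta>:
  assumes \<delta>: "\<delta> \<in> \<rat>"
  shows "galois_group f \<cong> integer_mod_group 3"
proof (rule is_isoI, rule isoI)
  define h :: "(complex \<Rightarrow> complex) \<Rightarrow> int" where "h \<tau> = (if \<tau> x = x then 0 else if \<tau> x = y then 1 else 2)" for \<tau>
  have car: "carrier (galois_group f) = field_auts L" "carrier (integer_mod_group 3) = {0..<3}"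
    by (simp_all add: carrier_galois_group L_def carrier_integer_mod_group)
  have cyc: "(\<tau> x, \<tau> y, \<tau> z) \<in> {(x, y, z), (y, z, x), (z, x, y)}" if "\<tau> \<in> field_auts L" for \<tau>
    by (rule rational_\<delta>_aut_cyclic[OF \<delta> that])
  show "h \<in> hom (galois_group f) (integer_mod_group 3)"
  proof (rule homI)
    show "h \<tau> \<in> carrier (integer_mod_group 3)" for \<tau> by (simp add: car h_def)
    fix \<sigma> \<tau> assume "\<sigma> \<in> carrier (galois_group f)" "\<tau> \<in> carrier (galois_group f)"
    then have st: "\<sigma> \<in> field_auts L" "\<tau> \<in> field_auts L" by (simp_all add: car)
    have m: "monoid.mult (galois_group f) \<sigma> \<tau> = compose L \<sigma> \<tau>"
      using st mult_galois_group unfolding L_def by blast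
    have "compose L \<sigma> \<tau> x = \<sigma> (\<tau> x)" using roots_L by (simp add: compose_eq)
    then show "h (monoid.mult (galois_group f) \<sigma> \<tau>) = monoid.mult (integer_mod_group 3) (h \<sigma>) (h \<tau>)"
      using cyc[OF st(1)] cyc[OF st(2)] roots_distinct unfolding m by (auto simp: h_def)
  qed
  have "inj_on h (field_auts L)"
  proof (rule inj_onI)
    fix \<sigma> \<tau> assume st: "\<sigma> \<in> field_auts L" "\<tau> \<in> field_auts L" "h \<sigma> = h \<tau>"
    then have "\<sigma> x = \<tau> x" using cyc[OF st(1)] cyc[OF st(2)] roots_distinct by (auto simp: h_def split: if_splits)
    then show "\<sigma> = \<tau>" using rational_\<delta>_aut_eqI[OF \<delta> st(1,2)] by blast
  qed
  moreover have "h ` field_auts L = {0..<3}"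
  proof (intro equalityI subsetI)
    fix i :: int assume "i \<in> {0..<3}"
    then consider "i = 0" | "i = 1" | "i = 2" by fastforce
    then have "\<exists>u\<in>{x, y, z}. i = (if u = x then 0 else if u = y then 1 else 2)"
      by cases (use roots_distinct in auto)
    then obtain u where u: "u \<in> {x, y, z}" "i = (if u = x then 0 else if u = y then 1 else 2)" by blast
    obtain \<tau> where "\<tau> \<in> field_auts L" "\<tau> x = u" using rational_\<delta>_aut_exists[OF \<delta> u(1)] .
    then show "i \<in> h ` field_auts L" using u(2) by (auto simp: h_def)
  qed (auto simp: h_def)
  ultimately show "bij_betw h (carrier (galois_group f)) (carrier (integer_mod_group 3))"
    unfolding car by (simp add: bij_betw_def)
qed

text \<open>Irrational \<open>\<delta>\<close> does not lie in \<open>\<rat>(x)\<close>. Applying \<open>\<sigma>\<close>, which fixes \<open>\<delta>\<close>, to the relation shows that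
it holds at all three roots. After reduction modulo \<open>f\<close> it becomes a polynomial of degree at most two with three roots and
coefficients \<open>p\<^sub>i + \<delta> q\<^sub>i\<close>, so all these coefficients vanish; this forces \<open>q\<^sub>i = 0\<close>, as \<open>\<delta>\<close> is irrational.\<close>

lemma quadratic_extension_coordinates:
  assumes \<sigma>: "\<sigma> \<in> field_auts L" "\<sigma> x = y" "\<sigma> y = z" "\<sigma> z = x" and irr: "\<delta> \<notin> \<rat>"
    and eq: "rat_eval p x + rat_eval q x * \<delta> = 0"
  shows "f dvd p" "f dvd q"
proof -
  have \<delta>L: "\<delta> \<in> L" unfolding \<delta>_def by (intro L_closed roots_L)
  have \<sigma>\<delta>: "\<sigma> \<delta> = \<delta>" unfolding aut_\<delta>[OF \<sigma>(1)] \<sigma>(2-4) by (simp add: \<delta>_def)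
  have step: "rat_eval p (\<sigma> u) + rat_eval q (\<sigma> u) * \<delta> = 0" if "rat_eval p u + rat_eval q u * \<delta> = 0" "u \<in> L" for u
  proof -
    have m: "rat_eval p u \<in> L" "rat_eval q u \<in> L" "rat_eval q u * \<delta> \<in> L"
      using rat_eval_in_subfield[OF L_subfield that(2)] \<delta>L L_closed by blast+
    have "\<sigma> (rat_eval p u + rat_eval q u * \<delta>) = rat_eval p (\<sigma> u) + rat_eval q (\<sigma> u) * \<delta>"
      using m \<delta>L by (simp add: field_aut_add[OF L_subfield \<sigma>(1)] field_aut_mult[OF L_subfield \<sigma>(1)]
          field_aut_rat_eval[OF L_subfield \<sigma>(1) that(2)] \<sigma>\<delta>)
    then show ?thesis unfolding that(1) using field_aut_rat[OF L_subfield \<sigma>(1), of 0] by simp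
  qed
  have eqs: "rat_eval p u + rat_eval q u * \<delta> = 0" if "u \<in> {x, y, z}" for u
    using that eq step[OF eq roots_L(1)] step[of y] roots_L \<sigma> by auto
  define p' q' where "p' = p mod f" and "q' = q mod f"
  define R where "R = map_poly of_rat p' + Polynomial.smult \<delta> (map_poly of_rat q')"
  have R0: "poly R u = 0" if "u \<in> {x, y, z}" for u
  proof -
    have "rat_eval f u = 0" using that unfolding f_eval by auto
    then have "rat_eval p' u = rat_eval p u" "rat_eval q' u = rat_eval q u"
      using arg_cong[OF div_mult_mod_eq[of p f], of "\<lambda>t. rat_eval t u"] arg_cong[OF div_mult_mod_eq[of q f], of "\<lambda>t. rat_eval t u"]
      unfolding p'_def q'_def by simp_all
    then show ?thesis using eqs[OF that] by (simp add: R_def rat_eval_def mult.commute)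
  qed
  have deg: "Polynomial.degree (g mod f) < 3" for g
    using degree_mod_less[OF f_nz, of g] f_degree by auto
  have co: "coeff R i = of_rat (coeff p' i) + \<delta> * of_rat (coeff q' i)" for i
    by (simp add: R_def coeff_map_poly)
  have "R = 0"
  proof (rule ccontr)
    assume "R \<noteq> 0"
    have "card {x, y, z} \<le> card {u. poly R u = 0}"
      using R0 poly_roots_finite[OF \<open>R \<noteq> 0\<close>] by (intro card_mono) auto
    moreover have "card {u. poly R u = 0} \<le> Polynomial.degree R" by (rule card_poly_roots_bound[OF \<open>R \<noteq> 0\<close>])
    moreover have "Polynomial.degree R \<le> 2"
    proof (rule degree_le, intro allI impI)
      fix i :: nat assume "2 < i"
      then have "coeff p' i = 0" "coeff q' i = 0"
        using deg[of p] deg[of q] unfolding p'_def q'_def by (auto intro!: coeff_eq_0)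
      then show "coeff R i = 0" unfolding co by simp
    qed
    moreover have "card {x, y, z} = 3" using roots_distinct by auto
    ultimately show False by linarith
  qed
  then have c0: "of_rat (coeff p' i) + \<delta> * of_rat (coeff q' i) = (0 :: complex)" for i using co[of i] by simp
  have q0: "coeff q' i = 0" for i
  proof (rule ccontr)
    assume nz: "coeff q' i \<noteq> 0"
    have "\<delta> * of_rat (coeff q' i) = of_rat (- coeff p' i)" using c0[of i] by (simp add: of_rat_minus add_eq_0_iff)
    then have "\<delta> = of_rat (- coeff p' i / coeff q' i)" using nz by (simp add: of_rat_divide of_rat_minus field_simps)
    then show False using irr by simp
  qed
  then have "coeff p' i = 0" for i using c0[of i] by simp
  then have "p' = 0" "q' = 0" using q0 by (simp_all add: poly_eq_iff)
  then show "f dvd p" "f dvd q" unfolding p'_def q'_def by (simp_all add: dvd_eq_mod_eq_0)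
qed

text \<open>Under these assumptions \<open>L\<close> is the quadratic extension of \<open>\<rat>(x)\<close> generated by \<open>\<delta>\<close>, and \<open>\<tau>\<close> is its
nontrivial automorphism over \<open>\<rat>(x)\<close>. The elements of \<open>L\<close> are parametrised by pairs of polynomials \<open>(p, q)\<close>.\<close>

lemma irrational_\<delta>_involution:
  assumes \<sigma>: "\<sigma> \<in> field_auts L" "\<sigma> x = y" "\<sigma> y = z" "\<sigma> z = x" and irr: "\<delta> \<notin> \<rat>"
  obtains \<tau> where "\<tau> \<in> field_auts L" "\<tau> \<delta> = - \<delta>" "\<And>w. w \<in> L \<Longrightarrow> \<tau> (\<tau> w) = w"
proof -
  note coord = quadratic_extension_coordinates[OF \<sigma> irr]
  define \<phi> where "\<phi> = (\<lambda>(p, q). rat_eval p x + rat_eval q x * \<delta>)"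
  define \<psi> where "\<psi> = (\<lambda>(p, q). rat_eval p x - rat_eval q x * \<delta>)"
  define d :: rat where "d = of_int (a ^ 2 - 4 * a ^ 3 + 4 * b - 27 * b ^ 2 - 18 * a * b)"
  have "\<delta> ^ 2 = of_rat d" unfolding disc d_def of_rat_of_int_eq ..
  then have d: "\<delta> * \<delta> = of_rat d" by (simp add: power2_eq_square)
  have \<psi>\<phi>: "\<psi> (p, q) = \<phi> (p, - q)" "\<phi> (p, q) = \<psi> (p, - q)" for p q by (simp_all add: \<phi>_def \<psi>_def)
  have add: "\<phi> (p + p', q + q') = \<phi> (p, q) + \<phi> (p', q')" "\<psi> (p + p', q + q') = \<psi> (p, q) + \<psi> (p', q')" for p q p' q'
    by (simp_all add: \<phi>_def \<psi>_def algebra_simps)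
  have mult: "\<phi> (p * p' + Polynomial.smult d (q * q'), p * q' + q * p') = \<phi> (p, q) * \<phi> (p', q')" 
    "\<psi> (p * p' + Polynomial.smult d (q * q'), p * q' + q * p') = \<psi> (p, q) * \<psi> (p', q')" for p q p' q'
    unfolding \<phi>_def \<psi>_def by (simp_all add: d[symmetric] algebra_simps)
  have zero: "\<phi> (p, q) = 0 \<longleftrightarrow> f dvd p \<and> f dvd q" for p q
    using coord[of p q] eval_eq_0_iff[of x p] eval_eq_0_iff[of x q] by (auto simp: \<phi>_def)
  have zero': "\<psi> (p, q) = 0 \<longleftrightarrow> f dvd p \<and> f dvd q" for p q
    using zero[of p "- q"] by (simp add: \<psi>\<phi>(1))
  have "\<psi> i \<in> range \<phi>" "\<phi> i \<in> range \<psi>" for i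
    by (cases i, simp add: \<psi>\<phi>(1)) (cases i, simp add: \<psi>\<phi>(2))
  then have ran: "range \<psi> = range \<phi>" by blast
  have rat: "\<phi> ([:c:], 0) = of_rat c" "\<psi> ([:c:], 0) = of_rat c" for c by (simp_all add: \<phi>_def \<psi>_def)
  have sub: "is_subfield (range \<phi>)"
    unfolding is_subfield_def
  proof (intro conjI subsetI ballI)
    fix q :: complex assume "q \<in> \<rat>"
    then show "q \<in> range \<phi>" using rat(1) by (metis Rats_cases rangeI)
  next
    fix u v assume "u \<in> range \<phi>" "v \<in> range \<phi>"
    then obtain p q p' q' where uv: "u = \<phi> (p, q)" "v = \<phi> (p', q')" by auto
    show "u + v \<in> range \<phi>" "u * v \<in> range \<phi>" unfolding uv add(1)[symmetric] mult(1)[symmetric] by blast+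
  next
    fix u assume "u \<in> range \<phi>"
    then obtain p q where u: "u = \<phi> (p, q)" by auto
    have "- u = \<phi> (- p, - q)" by (simp add: u \<phi>_def)
    then show "- u \<in> range \<phi>" by blast
    show "inverse u \<in> range \<phi>"
    proof (cases "u = 0")
      case True
      then show ?thesis using rat(1)[of 0] by (metis inverse_zero of_rat_0 rangeI)
    next
      case False
      \<comment> \<open>the norm from \<open>L\<close> to \<open>\<rat>(x)\<close>\<close>
      define N where "N = p * p - Polynomial.smult d (q * q)"
      have N: "rat_eval N x = \<phi> (p, q) * \<psi> (p, q)"
        unfolding N_def \<phi>_def \<psi>_def by (simp add: d[symmetric] algebra_simps)
      have "\<psi> (p, q) \<noteq> 0" using False zero zero' u by simp
      then have "\<not> f dvd N" using eval_eq_0_iff[of x N] False unfolding N u by simp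
      then obtain r where r: "rat_eval N x * rat_eval r x = 1" using eval_inverse by blast
      have "inverse u = \<psi> (p, q) * rat_eval r x"
        using r unfolding N u by (intro inverse_unique) (simp add: mult.assoc)
      also have "\<dots> = \<phi> (p * r, - (q * r))" by (simp add: \<phi>_def \<psi>_def algebra_simps)
      finally show ?thesis by simp
    qed
  qed
  have "L = range \<phi>"
  proof
    obtain r where r: "y = rat_eval [:1/2, -1/2:] x - rat_eval r x * \<delta>" "z = rat_eval [:1/2, -1/2:] x + rat_eval r x * \<delta>"
      using other_roots .
    have "x = \<phi> ([:0, 1:], 0)" "y = \<phi> ([:1/2, -1/2:], - r)" "z = \<phi> ([:1/2, -1/2:], r)"
      unfolding \<phi>_def by simp (use r in simp_all)
    then show "L \<subseteq> range \<phi>" by (intro L_least sub) blast+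
    have "\<delta> \<in> L" unfolding \<delta>_def by (intro L_closed roots_L)
    then show "range \<phi> \<subseteq> L" using rat_eval_in_subfield[OF L_subfield roots_L(1)]
      by (auto simp: \<phi>_def intro!: L_closed(2,3))
  qed
  note L = this
  obtain \<tau> where \<tau>: "\<tau> \<in> field_auts L" "\<And>i. \<tau> (\<phi> i) = \<psi> i"
  proof (rule field_aut_from_parametrisation[of \<phi> L \<psi>])
    show "range \<phi> = L" "range \<psi> = L" using L ran by simp_all
    show "\<phi> i = \<phi> j \<longleftrightarrow> \<psi> i = \<psi> j" for i j
    proof -
      obtain p q p' q' where ij: "i = (p, q)" "j = (p', q')" by (cases i; cases j)
      have "\<phi> i = \<phi> j \<longleftrightarrow> \<phi> (p - p', q - q') = 0" "\<psi> i = \<psi> j \<longleftrightarrow> \<psi> (p - p', q - q') = 0"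
        unfolding ij by (auto simp: \<phi>_def \<psi>_def algebra_simps)
      then show ?thesis unfolding zero zero' by simp
    qed
    show "\<exists>k. \<phi> k = \<phi> i + \<phi> j \<and> \<psi> k = \<psi> i + \<psi> j" for i j
      using add by (metis surj_pair)
    show "\<exists>k. \<phi> k = \<phi> i * \<phi> j \<and> \<psi> k = \<psi> i * \<psi> j" for i j
      using mult by (metis surj_pair)
    show "\<exists>k. \<phi> k = q \<and> \<psi> k = q" if "q \<in> \<rat>" for q
      using that rat by (metis Rats_cases)
  qed blast
  have "\<tau> \<delta> = - \<delta>" using \<tau>(2)[of "(0, 1)"] by (simp add: \<phi>_def \<psi>_def)
  moreover have "\<tau> (\<tau> w) = w" if wL: "w \<in> L" for w
  proof -
    obtain p q where w: "w = \<phi> (p, q)" using wL L by auto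
    show ?thesis unfolding w \<tau>(2) \<psi>\<phi>(1) by (simp add: \<tau>(2) \<psi>\<phi>(1))
  qed
  ultimately show thesis using that \<tau>(1) by blast
qed

end

text \<open>The rationals are fixed by \<open>\<sigma>\<close>, whereas no root is; and the involution that an irrational \<open>\<delta>\<close> would give rise
to is excluded by assumption.\<close>

lemma (in cubic_roots) three_cycle_imp:
  assumes \<sigma>: "\<sigma> \<in> field_auts L" "\<sigma> x = y" "\<sigma> y = z" "\<sigma> z = x" and ne: "x \<noteq> y"
    and no_invol: "\<And>\<tau>. \<tau> \<in> field_auts L \<Longrightarrow> (\<And>w. w \<in> L \<Longrightarrow> \<tau> (\<tau> w) = w) \<Longrightarrow> (\<And>w. w \<in> L \<Longrightarrow> \<tau> w = w)"
  shows "x \<notin> \<rat> \<and> y \<notin> \<rat> \<and> z \<notin> \<rat> \<and> \<delta> \<in> \<rat>"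
proof -
  have d: "y \<noteq> z" "z \<noteq> x" using ne \<sigma> field_aut_inj[OF L_subfield \<sigma>(1)] roots_L by metis+
  have irr: "x \<notin> \<rat>" "y \<notin> \<rat>" "z \<notin> \<rat>" using ne d \<sigma> field_aut_rat[OF L_subfield \<sigma>(1)] by metis+
  interpret irreducible_cubic_roots a b x y z by unfold_locales (rule irr)+
  have "\<delta> \<in> \<rat>"
  proof (rule ccontr)
    assume "\<delta> \<notin> \<rat>"
    then obtain \<tau> where \<tau>: "\<tau> \<in> field_auts L" "\<tau> \<delta> = - \<delta>" "\<And>w. w \<in> L \<Longrightarrow> \<tau> (\<tau> w) = w"
      using irrational_\<delta>_involution[OF \<sigma>] by blast
    have "\<delta> \<in> L" unfolding \<delta>_def by (intro L_closed roots_L)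
    then have "\<tau> \<delta> = \<delta>" using no_invol[OF \<tau>(1)] \<tau>(3) by blast
    then show False using \<tau>(2) \<delta>_nz by simp
  qed
  then show ?thesis using irr by blast
qed

text \<open>An element \<open>\<sigma>\<close> of order three moves some root \<open>u\<close>, and then \<open>u, \<sigma> u, \<sigma> (\<sigma> u)\<close> are three distinct
roots. Thus \<open>\<sigma>\<close> permutes the roots cyclically, possibly in the opposite direction, for which \<open>y\<close> and \<open>z\<close>
are interchanged. A group of order three contains no involution.\<close>

lemma (in cubic_roots) cyclic_galois_group_imp:
  assumes G: "galois_group f \<cong> integer_mod_group 3"
  shows "x \<notin> \<rat> \<and> y \<notin> \<rat> \<and> z \<notin> \<rat> \<and> \<delta> \<in> \<rat>"
proof -
  obtain h where h: "h \<in> iso (galois_group f) (integer_mod_group 3)" using G by (auto simp: is_iso_def)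
  have car: "carrier (galois_group f) = field_auts L" "carrier (integer_mod_group 3) = {0..<3}"
    by (simp_all add: carrier_galois_group L_def carrier_integer_mod_group)
  have bij: "bij_betw h (field_auts L) {0..<3}" using h by (simp add: iso_def car)
  have hm: "h (compose L \<sigma> \<tau>) = (h \<sigma> + h \<tau>) mod 3" if "\<sigma> \<in> field_auts L" "\<tau> \<in> field_auts L" for \<sigma> \<tau>
  proof -
    have "h (monoid.mult (galois_group f) \<sigma> \<tau>) = (h \<sigma> + h \<tau>) mod 3"
      using h that unfolding iso_def hom_def by (simp add: car)
    moreover have "monoid.mult (galois_group f) \<sigma> \<tau> = compose L \<sigma> \<tau>"
      using mult_galois_group[of \<sigma> f \<tau>] that unfolding L_def by blast
    ultimately show ?thesis by simp
  qed
  have hr: "0 \<le> h \<tau>" "h \<tau> < 3" if "\<tau> \<in> field_auts L" for \<tau> using bij that by (auto simp: bij_betw_def)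
  have inj: "\<sigma> = \<tau>" if "\<sigma> \<in> field_auts L" "\<tau> \<in> field_auts L" "h \<sigma> = h \<tau>" for \<sigma> \<tau>
    using bij that by (auto simp: bij_betw_def inj_on_def)
  define e where "e = (\<lambda>w\<in>L. w)"
  have e: "e \<in> field_auts L" unfolding e_def by (rule field_aut_id[OF L_subfield])
  have "compose L e e = e" by (auto simp: e_def compose_def fun_eq_iff)
  then have "h e = (h e + h e) mod 3" using hm[OF e e] by simp
  then have he: "h e = 0" using hr[OF e] by presburger
  have no_invol: "\<tau> w = w" if \<tau>: "\<tau> \<in> field_auts L" and inv: "\<And>w. w \<in> L \<Longrightarrow> \<tau> (\<tau> w) = w" and w: "w \<in> L" for \<tau> w
  proof -
    have "compose L \<tau> \<tau> = e" using inv by (auto simp: e_def compose_def fun_eq_iff)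
    then have h0: "(h \<tau> + h \<tau>) mod 3 = 0" using hm[OF \<tau> \<tau>] he by simp
    have "t = 0" if "(t + t) mod 3 = 0" "0 \<le> t" "t < 3" for t :: int using that by presburger
    from this[OF h0 hr[OF \<tau>]] have "h \<tau> = h e" unfolding he .
    then have "\<tau> = e" using inj \<tau> e by blast
    then show ?thesis using w by (simp add: e_def)
  qed
  have "1 \<in> h ` field_auts L" using bij by (auto simp: bij_betw_def)
  then obtain \<sigma> where \<sigma>: "\<sigma> \<in> field_auts L" "h \<sigma> = 1" by auto
  have \<sigma>2: "compose L \<sigma> \<sigma> \<in> field_auts L" by (rule field_aut_compose[OF L_subfield \<sigma>(1) \<sigma>(1)])
  have "h (compose L \<sigma> (compose L \<sigma> \<sigma>)) = h e"
    using hm[OF \<sigma>(1) \<sigma>2] hm[OF \<sigma>(1) \<sigma>(1)] \<sigma>(2) he by simp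
  then have c3: "compose L \<sigma> (compose L \<sigma> \<sigma>) = e" using inj field_aut_compose[OF L_subfield \<sigma>(1) \<sigma>2] e by blast
  have \<sigma>3: "\<sigma> (\<sigma> (\<sigma> w)) = w" if "w \<in> L" for w
  proof -
    have "compose L \<sigma> (compose L \<sigma> \<sigma>) w = e w" by (simp only: c3)
    then show ?thesis using that by (simp add: compose_eq e_def)
  qed
  have "\<sigma> \<noteq> e" using \<sigma>(2) he by auto
  then obtain u where u: "u \<in> {x, y, z}" "\<sigma> u \<noteq> u"
    using field_aut_determined_on_roots[of \<sigma> f] \<sigma>(1) f_roots unfolding e_def L_def by blast
  have iff: "\<sigma> v = \<sigma> w \<longleftrightarrow> v = w" if "v \<in> {x, y, z}" "w \<in> {x, y, z}" for v w
    using field_aut_inj[OF L_subfield \<sigma>(1)] that roots_L by blast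
  define v w where "v = \<sigma> u" and "w = \<sigma> v"
  have vw: "v \<in> {x, y, z}" "w \<in> {x, y, z}" using aut_root[OF \<sigma>(1)] u(1) unfolding v_def w_def by blast+
  have cyc: "\<sigma> u = v" "\<sigma> v = w" "\<sigma> w = u" using \<sigma>3[of u] u(1) roots_L by (auto simp: v_def w_def)
  have dist: "u \<noteq> v" "v \<noteq> w" "w \<noteq> u"
    using u(2) cyc iff[OF u(1) vw(1)] iff[OF vw(1) vw(2)] by auto
  have "(u, v, w) \<in> {(x, y, z), (y, z, x), (z, x, y), (x, z, y), (z, y, x), (y, x, z)}"
    using u(1) vw dist by auto
  then consider "\<sigma> x = y" "\<sigma> y = z" "\<sigma> z = x" "x \<noteq> y" | "\<sigma> x = z" "\<sigma> z = y" "\<sigma> y = x" "x \<noteq> z"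
    using cyc dist by auto
  then show ?thesis
  proof cases
    case 1
    then show ?thesis using three_cycle_imp[OF \<sigma>(1)] no_invol by blast
  next
    case 2
    interpret xzy: cubic_roots a b x z y by (rule swap)
    have "x \<notin> \<rat> \<and> z \<notin> \<rat> \<and> y \<notin> \<rat> \<and> xzy.\<delta> \<in> \<rat>" using xzy.three_cycle_imp[OF \<sigma>(1) 2] no_invol by blast
    moreover have "\<delta> = - xzy.\<delta>" unfolding \<delta>_def xzy.\<delta>_def by (simp add: algebra_simps)
    ultimately show ?thesis by simp
  qed
qed

theorem (in cubic_roots) galois_group_cyclic_iff:
  "galois_group f \<cong> integer_mod_group 3 \<longleftrightarrow> x \<notin> \<rat> \<and> y \<notin> \<rat> \<and> z \<notin> \<rat> \<and> \<delta> \<in> \<rat>"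
proof
  assume r: "x \<notin> \<rat> \<and> y \<notin> \<rat> \<and> z \<notin> \<rat> \<and> \<delta> \<in> \<rat>"
  then interpret irreducible_cubic_roots a b x y z by unfold_locales auto
  show "galois_group f \<cong> integer_mod_group 3" using galois_group_cyclic_if_rational_\<delta> r by blast
qed (rule cyclic_galois_group_imp)

section \<open>The number of cyclic cubics\<close>

lemma rat_root_of_monic_int_poly:
  fixes t :: complex
  assumes "t \<in> \<rat>" "poly (map_poly of_int p) t = 0" "lead_coeff p = 1"
  shows "t \<in> \<int>"
  using assms rational_algebraic_int_is_int[of t] algebraic_int_altdef_ipoly[of t] by blast

lemma cubic_roots_exist: "\<exists>x y z. cubic_roots a b x y z"
proof -
  have "\<exists>x. poly [:of_int b, of_int a, -1, 1:] (x :: complex) = 0"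
    by (rule fundamental_theorem_of_algebra_alt) auto
  then obtain x :: complex where x: "poly [:of_int b, of_int a, -1, 1:] x = 0" by blast
  have "\<exists>y. poly [:of_int a - x * (1 - x), x - 1, 1:] (y :: complex) = 0"
    by (rule fundamental_theorem_of_algebra_alt) auto
  then obtain y :: complex where y: "poly [:of_int a - x * (1 - x), x - 1, 1:] y = 0" by blast
  define z where "z = 1 - x - y"
  have a: "of_int a = x * y + y * z + z * x" using y by (simp add: z_def algebra_simps)
  have "of_int b = x ^ 2 - x ^ 3 - of_int a * x"
    using x by (simp add: power2_eq_square power3_eq_cube algebra_simps add_eq_0_iff)
  then have "x * y * z = - of_int b" unfolding a by (simp add: z_def power2_eq_square power3_eq_cube algebra_simps)
  then have "cubic_roots a b x y z" using a by unfold_locales (simp_all add: z_def)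
  then show ?thesis by blast
qed

text \<open>Roots and \<open>\<delta>\<close> are zeros of monic integer polynomials, so as soon as they are rational they are integers.\<close>

theorem mem_F_iff: "[:b, a, -1, 1:] \<in> F \<longleftrightarrow> \<not> has_int_root a b \<and> (\<exists>k. (b, k) \<in> square_disc a)"
proof -
  obtain x y z where "cubic_roots a b x y z" using cubic_roots_exist by blast
  then interpret cubic_roots a b x y z .
  define D where "D = a ^ 2 - 4 * a ^ 3 + 4 * b - 27 * b ^ 2 - 18 * a * b"
  have D: "(b, k) \<in> square_disc a \<longleftrightarrow> k ^ 2 = D" for k
  proof -
    have "4 * (1 - 3 * a) ^ 3 - (27 * b + 9 * a - 2) ^ 2 = 27 * D"
      by (simp add: D_def power2_eq_square power3_eq_cube algebra_simps)
    then show ?thesis unfolding square_disc_def by auto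
  qed
  have "[:b, a, -1, 1:] \<in> F \<longleftrightarrow> galois_group f \<cong> integer_mod_group 3"
    unfolding F_def f_def by auto
  also have "\<dots> \<longleftrightarrow> (x \<notin> \<rat> \<and> y \<notin> \<rat> \<and> z \<notin> \<rat>) \<and> \<delta> \<in> \<rat>"
    unfolding galois_group_cyclic_iff by blast
  also have "(x \<notin> \<rat> \<and> y \<notin> \<rat> \<and> z \<notin> \<rat>) \<longleftrightarrow> \<not> has_int_root a b"
  proof -
    have root: "t \<in> {x, y, z} \<longleftrightarrow> t ^ 3 - t ^ 2 + of_int a * t + of_int b = 0" for t
    proof -
      have "rat_eval f t = t ^ 3 - t ^ 2 + of_int a * t + of_int b"
        by (simp add: f_eq power2_eq_square power3_eq_cube algebra_simps)
      then show ?thesis using f_eval[of t] by auto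
    qed
    have int: "(of_int n :: complex) ^ 3 - of_int n ^ 2 + of_int a * of_int n + of_int b = 0
        \<longleftrightarrow> n ^ 3 - n ^ 2 + a * n + b = 0" for n
      by (metis (mono_tags, opaque_lifting) of_int_0_eq_iff of_int_add of_int_diff of_int_mult of_int_power)
    have "has_int_root a b" if t: "t \<in> {x, y, z}" "t \<in> \<rat>" for t
    proof -
      have "poly (map_poly of_int [:b, a, -1, 1:]) t = 0"
        using t(1) unfolding root by (simp add: map_poly_pCons power2_eq_square power3_eq_cube algebra_simps)
      then have "t \<in> \<int>" using rat_root_of_monic_int_poly[OF t(2), of "[:b, a, -1, 1:]"] by simp
      then obtain n where "t = of_int n" by (auto elim: Ints_cases)
      then show ?thesis using t(1) unfolding root has_int_root_def using int by auto
    qed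
    moreover have "\<exists>t\<in>{x, y, z}. t \<in> \<rat>" if red: "has_int_root a b"
    proof -
      obtain n where "n ^ 3 - n ^ 2 + a * n + b = 0" using red unfolding has_int_root_def by blast
      then have "of_int n \<in> {x, y, z}" unfolding root int .
      then show ?thesis by (intro bexI[of _ "of_int n"]) auto
    qed
    ultimately show ?thesis by blast
  qed
  also have "\<delta> \<in> \<rat> \<longleftrightarrow> (\<exists>k. (b, k) \<in> square_disc a)"
  proof
    assume q: "\<delta> \<in> \<rat>"
    have "poly (map_poly of_int [:- D, 0, 1:]) \<delta> = 0"
      using disc by (simp add: map_poly_pCons D_def power2_eq_square)
    then have "\<delta> \<in> \<int>" using rat_root_of_monic_int_poly[OF q, of "[:- D, 0, 1:]"] by simp
    then obtain k where "\<delta> = of_int k" by (auto elim: Ints_cases)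
    then have "of_int (k ^ 2) = (of_int D :: complex)" using disc by (simp add: D_def)
    then have "k ^ 2 = D" by (simp only: of_int_eq_iff)
    then show "\<exists>k. (b, k) \<in> square_disc a" using D by blast
  next
    assume "\<exists>k. (b, k) \<in> square_disc a"
    then obtain k where "k ^ 2 = D" using D by blast
    then have "\<delta> ^ 2 = of_int (k ^ 2)" using disc unfolding D_def by simp
    then have "\<delta> ^ 2 = (of_int k) ^ 2" by simp
    then have "\<delta> = of_int k \<or> \<delta> = - of_int k" by (simp only: power2_eq_iff)
    then show "\<delta> \<in> \<rat>" by auto
  qed
  finally show ?thesis .
qed

theorem theorem2:
  shows "(\<forall>a b :: int. [:b, a, -1, 1:] \<in> F \<longrightarrow> a \<le> 0) \<and>
    (\<forall>a :: int. a \<le> 0 \<longrightarrow>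
       finite {f \<in> F. \<exists>b. f = [:b, a, -1, 1:]} \<and>
       finite (E (sqrt (1 - 3 * real_of_int a)) \<inter> \<int> \<times> \<int>) \<and>
       real (card {f \<in> F. \<exists>b. f = [:b, a, -1, 1:]}) =
         1/2 * (\<Sum>d | d dvd nat (1 - 3 * a). 3 ^ \<omega> (P 1 d) * (-1) ^ \<Omega> (P 2 d))
         - 1/6 * real (card (E (sqrt (1 - 3 * real_of_int a)) \<inter> \<int> \<times> \<int>)))"
proof (intro conjI allI impI)
  fix a b :: int
  assume "[:b, a, -1, 1:] \<in> F"
  then obtain k where k: "(b, k) \<in> square_disc a" unfolding mem_F_iff by blast
  then have "4 * (1 - 3 * a) ^ 3 = (27 * b + 9 * a - 2) ^ 2 + 27 * k ^ 2" by (simp add: square_disc_def)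
  then have "(1 - 3 * a) ^ 3 \<ge> 0" by (smt (verit) zero_le_power2)
  then have "1 - 3 * a \<ge> 0" by (simp add: zero_le_power_eq)
  then show "a \<le> 0" by presburger
next
  fix a :: int assume a: "a \<le> 0"
  let ?B = "{b. \<not> has_int_root a b \<and> (\<exists>k. (b, k) \<in> square_disc a)}"
  have F: "{f \<in> F. \<exists>b. f = [:b, a, -1, 1:]} = (\<lambda>b. [:b, a, -1, 1:]) ` ?B"
    by (auto simp: mem_F_iff)
  have inj: "inj_on (\<lambda>b. [:b, a, -1, 1:]) ?B" by (auto simp: inj_on_def)
  show "finite {f \<in> F. \<exists>b. f = [:b, a, -1, 1:]}"
    unfolding F by (intro finite_imageI count_irreducible_square_disc(1)[OF a])
  show "finite (E (sqrt (1 - 3 * real_of_int a)) \<inter> \<int> \<times> \<int>)" by (rule card_E_integer_points(1)[OF a])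
  show "real (card {f \<in> F. \<exists>b. f = [:b, a, -1, 1:]}) =
         1/2 * (\<Sum>d | d dvd nat (1 - 3 * a). 3 ^ \<omega> (P 1 d) * (-1) ^ \<Omega> (P 2 d))
         - 1/6 * real (card (E (sqrt (1 - 3 * real_of_int a)) \<inter> \<int> \<times> \<int>))"
    unfolding F card_image[OF inj] card_E_integer_points(2)[OF a]
    using count_irreducible_square_disc(2)[OF a] unfolding divisor_weight_def .
qed

end
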